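(* Let $d\ge 1$ be an integer, let $s_0=0<s_1<s_2<\dots<s_d$ be real numbers and let $t_0=0\le t_1<t_2<\dots<t_d\le 1=t_{d+1}$. Let $\mathbb{B}^{me}=(\mathbb{B}^{me}_t)_{t\in[0,1]}$ be the Brownian meander, and let $(X_t)_{t\ge 0}$ be the Markov process on $[0,\infty)$ with transition densities $$p_t(x,y)=\frac{2t\sqrt{y}}{\pi\left[(y-x)^2+2(x+y)t^2+t^4\right]},\qquad t>0,\ x,y\ge 0,$$ with $\mathbb{E}_x$ denoting expectation when $X_0=x$. Then $$\mathbb{E}\left[\exp\left(-\sum_{k=1}^d (s_k-s_{k-1})\mathbb{B}^{me}_{1-t_k}\right)\right]=\frac{1}{\sqrt{2\pi}}\int_0^\infty \mathbb{E}_x\left[\exp\left(-\frac12\sum_{k=0}^{d}(t_{k+1}-t_k)X_{s_k}\right)\right]\frac{1}{\sqrt{x}}\,dx.$$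
   Context: Brownian meander: $\mathbb{B}^{me}=(\mathbb{B}^{me}_t)_{t\in[0,1]}$ is Brownian motion (started at $0$) conditioned to stay positive over the time interval $[0,1]$. Explicitly, $\mathbb{B}^{me}_0=0$ and its joint density at times $0<r_1<\dots<r_d\le 1$ is $$\sqrt{2\pi}\,\ell_{r_1}(y_1)\left(\prod_{k=1}^{d-1}g_{r_{k+1}-r_k}(y_k,y_{k+1})\right)h_{1-r_d}(y_d),$$ where $\ell_t(y)=\frac{1}{\sqrt{2\pi t^3}}\,y\,e^{-y^2/(2t)}\mathbf{1}_{\{y>0\}}$, $g_t(y_1,y_2)=\frac{1}{\sqrt{2\pi t}}\left[e^{-(y_1-y_2)^2/(2t)}-e^{-(y_1+y_2)^2/(2t)}\right]\mathbf{1}_{\{y_1,y_2>0\}}$, $h_u(y)=\int_0^\infty g_u(y,w)\,dw$ for $u>0$, and $h_0(y)=\mathbf{1}_{\{y>0\}}$. Process $X$: $(X_t)_{t\ge0}$ is the time-homogeneous Markov process with state space $[0,\infty)$ and transition probabilities $\mathbb{P}(X_t\in dy\mid X_s=x)=p_{t-s}(x,y)\,dy$ for $0\le s<t$, $x\ge 0$, with $p_t(x,y)$ as in the statement. For $x>0$, $\mathbb{E}_x$ is the expectation for the law of $(X_t)_{t\ge 0}$ started at $X_0=x$. *)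

theory Defs
  imports "HOL-Probability.Probability"
begin

definition meander_entrance :: "real \<Rightarrow> real \<Rightarrow> real" where
  "meander_entrance t y =
     (if y > 0 then 1 / sqrt (2 * pi * t ^ 3) * y * exp (- y\<^sup>2 / (2 * t)) else 0)"

definition killed_kernel :: "real \<Rightarrow> real \<Rightarrow> real \<Rightarrow> real" where
  "killed_kernel t y z =
     (if y > 0 \<and> z > 0
      then 1 / sqrt (2 * pi * t) * (exp (- (y - z)\<^sup>2 / (2 * t)) - exp (- (y + z)\<^sup>2 / (2 * t)))
      else 0)"

definition killed_survival :: "real \<Rightarrow> real \<Rightarrow> real" where
  "killed_survival u y =
     (if u = 0 then indicator {0<..} y else (LINT w:{0<..}|lborel. killed_kernel u y w))"

definition meander_density :: "nat \<Rightarrow> (nat \<Rightarrow> real) \<Rightarrow> (nat \<Rightarrow> real) \<Rightarrow> real" where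
  "meander_density d r y =
     sqrt (2 * pi) * meander_entrance (r 1) (y 1) *
     (\<Prod>k=1..<d. killed_kernel (r (k + 1) - r k) (y k) (y (k + 1))) *
     killed_survival (1 - r d) (y d)"

(* The meander is specified by its finite-dimensional distributions; continuity of the
   paths is not required. *)
locale brownian_meander = prob_space M
  for M :: "'a measure" +
  fixes B :: "real \<Rightarrow> 'a \<Rightarrow> real"
  assumes random_variable_zero: "random_variable borel (B 0)"
    and start_zero: "AE \<omega> in M. B 0 \<omega> = 0"
    and joint_density:
      "\<And>(d::nat) (r::nat \<Rightarrow> real).
         \<lbrakk>d \<ge> 1; 0 < r 1; \<And>k. k \<in> {1..<d} \<Longrightarrow> r k < r (k + 1); r d \<le> 1\<rbrakk> \<Longrightarrow>
         distributed M (\<Pi>\<^sub>M k\<in>{1..d}. lborel) (\<lambda>\<omega>. \<lambda>k\<in>{1..d}. B (r k) \<omega>)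
           (\<lambda>y. ennreal (meander_density d r y))"

definition trans_density :: "real \<Rightarrow> real \<Rightarrow> real \<Rightarrow> real" where
  "trans_density t x y =
     2 * t * sqrt y / (pi * ((y - x)\<^sup>2 + 2 * (x + y) * t\<^sup>2 + t ^ 4))"

definition natural_filtration :: "'a measure \<Rightarrow> (real \<Rightarrow> 'a \<Rightarrow> real) \<Rightarrow> real \<Rightarrow> 'a measure" where
  "natural_filtration N X s =
     sigma (space N) {X u -` A \<inter> space N | u A. u \<in> {0..s} \<and> A \<in> sets borel}"

(* The density is only meaningful for nonnegative arguments (sqrt is an odd function on the
   reals), hence the intersection with the state space {0..}. *)
locale markov_process_from = prob_space N
  for N :: "'a measure" +
  fixes X :: "real \<Rightarrow> 'a \<Rightarrow> real" and x :: real
  assumes random_variable_X: "\<And>t. t \<ge> 0 \<Longrightarrow> random_variable (restrict_space borel {0..}) (X t)"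
    and start: "AE \<omega> in N. X 0 \<omega> = x"
    and markov:
      "\<And>s t A. \<lbrakk>0 \<le> s; s < t; A \<in> sets borel\<rbrakk> \<Longrightarrow>
         AE \<omega> in N. real_cond_exp N (natural_filtration N X s) (\<lambda>\<omega>. indicator A (X t \<omega>)) \<omega> =
           (LINT y:A \<inter> {0..}|lborel. trans_density (t - s) (X s \<omega>) y)"

end

theory Submission
  imports Defs
begin

text \<open>
  Both sides are one and the same iterated integral, because a sine transform exchanges the kernels
  of the two processes. Brownian motion killed at \<open>0\<close> has the transition density
  \<open>g\<^sub>t(y, z) = 2/\<pi> \<integral> sin (u y) sin (u z) exp (- t u\<^sup>2 / 2) du\<close> over \<open>u > 0\<close>, so the sine transform
  turns its semigroup into multiplication by \<open>exp (- t u\<^sup>2 / 2)\<close>. In the variables \<open>x = u\<^sup>2\<close> and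
  \<open>y = v\<^sup>2\<close> the transition density of \<open>X\<close> becomes, up to a Jacobian, the difference of two Cauchy
  densities \<open>q\<^sub>t(u, v) = 2/\<pi> \<integral> sin (u y) sin (v y) exp (- t y) dy\<close> over \<open>y > 0\<close>, and its semigroup
  is turned into multiplication by \<open>exp (- t y)\<close>. On each side the exponential weights are thus the
  transformed semigroup of the other side: the increments \<open>\<sigma> k = s k - s (k - 1)\<close> are weights for the
  meander and running times for \<open>X\<close>, and for the increments \<open>\<tau> k = t (k + 1) - t k\<close> the roles are
  reversed.

  Two recursively defined sequences of functions carry this out. The function \<open>meander_weight \<sigma> \<tau> k\<close>
  integrates out the meander at its late times, starting from the survival probability and going
  backwards in time (\<open>meander_weight_chain_total\<close>). The function \<open>process_weight \<sigma> \<tau> k\<close> is the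
  weighted density of \<open>X\<close> after \<open>k\<close> transitions, started from \<open>dx / sqrt x\<close>
  (\<open>process_weight_functional\<close>). By \<open>sine_duality\<close> the value of \<open>process_weight \<sigma> \<tau> (k + 1)\<close> at
  \<open>u\<^sup>2\<close> is the sine transform of \<open>meander_weight \<sigma> \<tau> k\<close> at \<open>u\<close>, damped by a Gaussian factor. The
  proof is an induction on \<open>k\<close> in which each step applies Fubini's theorem to both sine
  representations. The entrance law of the meander is also a sine transform, and this closes the chain
  of integrals at the other end (\<open>laplace_duality\<close>).

  The starting point of the induction needs care, since the survival probability is a sine integral
  with the factor \<open>1 / u\<close>. If \<open>t 1 > 0\<close>, this factor is absorbed into the bounded kernel
  \<open>sin (u y) / (u y)\<close>; if \<open>t 1 = 0\<close>, the sine integral converges only conditionally, and both sides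
  are evaluated in closed form (\<open>odd_cauchy_survival_integral\<close>). If \<open>t d = 1\<close>, the meander is
  evaluated at time \<open>0\<close>, where it vanishes, and \<open>X\<close> at the last time has weight \<open>0\<close>, so that the
  claim reduces to \<open>d - 1\<close> times.
\<close>

section \<open>Tools from integration theory\<close>

text \<open>
  A bounded kernel leaves the double integral dominated by a product of two integrable functions.
  Every interchange of signed integrals below has this form, with the kernel \<open>sin (u y)\<close>, \<open>cos (u z)\<close> or
  \<open>sin (u y) / (u y)\<close>.
\<close>
lemma bounded_kernel_Fubini:
  fixes F H :: "real \<Rightarrow> real" and \<kappa> :: "real \<Rightarrow> real \<Rightarrow> real"
  assumes F: "integrable lborel F" and H: "integrable lborel H"
    and [measurable]: "case_prod \<kappa> \<in> borel_measurable (borel \<Otimes>\<^sub>M borel)"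
    and bound: "\<And>u y. \<bar>\<kappa> u y\<bar> \<le> 1"
  shows "(\<integral>y. F y * (\<integral>u. \<kappa> u y * H u \<partial>lborel) \<partial>lborel) =
    (\<integral>u. H u * (\<integral>y. \<kappa> u y * F y \<partial>lborel) \<partial>lborel)" (is ?exchange)
    and "integrable lborel (\<lambda>u. H u * (\<integral>y. \<kappa> u y * F y \<partial>lborel))" (is ?integrable)
proof -
  have [measurable]: "F \<in> borel_measurable borel" "H \<in> borel_measurable borel"
    using F H by (auto dest: borel_measurable_integrable)
  have prod: "integrable (lborel \<Otimes>\<^sub>M lborel) (\<lambda>(u, y). H u * F y)"
    by (rule lborel_pair.Fubini_integrable) (use F H in \<open>auto simp: abs_mult\<close>)
  have int: "integrable (lborel \<Otimes>\<^sub>M lborel) (\<lambda>(u, y). \<kappa> u y * (H u * F y))"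
  proof (rule Bochner_Integration.integrable_bound[OF prod])
    show "AE x in lborel \<Otimes>\<^sub>M lborel. norm (case x of (u, y) \<Rightarrow> \<kappa> u y * (H u * F y)) \<le> norm (case x of (u, y) \<Rightarrow> H u * F y)"
      using bound by (intro AE_I2) (auto simp: abs_mult split_beta intro!: mult_left_le_one_le)
  qed measurable
  from lborel_pair.Fubini_integral[OF int] show ?exchange
    by (subst (1 2) integral_mult_right_zero[symmetric]) (simp add: mult_ac)
  from lborel_pair.integrable_fst[OF int] show ?integrable
    by (subst integral_mult_right_zero[symmetric]) (simp add: mult_ac)
qed

lemma half_line_FTC:
  fixes f G :: "real \<Rightarrow> real"
  assumes deriv: "\<And>x. (G has_real_derivative f x) (at x)"
    and cont: "\<And>x. isCont f x"
    and int: "integrable lborel (\<lambda>x. f x * indicator {0<..} x)"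
    and lim: "(G \<longlongrightarrow> L) at_top"
  shows "(\<integral>x. f x * indicator {0<..} x \<partial>lborel) = L - G 0"
proof -
  have "(LBINT x=ereal 0..\<infinity>. f x) = L - G 0"
  proof (rule interval_integral_FTC_integrable)
    show "(G has_vector_derivative f x) (at x)" for x
      using deriv by (simp add: has_real_derivative_iff_has_vector_derivative)
    have "isCont G 0" using deriv DERIV_isCont by blast
    then show "((G \<circ> real_of_ereal) \<longlongrightarrow> G 0) (at_right (ereal 0))"
      by (simp add: ereal_tendsto_simps isCont_def filterlim_at_split)
    show "((G \<circ> real_of_ereal) \<longlongrightarrow> L) (at_left \<infinity>)"
      using lim by (simp add: ereal_tendsto_simps)
    show "set_integrable lborel (einterval (ereal 0) \<infinity>) f"
      using int by (simp add: set_integrable_def mult.commute)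
  qed (use cont in auto)
  then show ?thesis
    by (simp add: interval_integral_to_infinity_eq set_lebesgue_integral_def mult.commute)
qed

text \<open>
  Monotone convergence extends the substitution rule from the intervals \<open>{0..n + 1}\<close>. This is the
  change between the state \<open>x\<close> of the process and the frequency \<open>u\<close> of the sine transform.
\<close>
lemma nn_integral_square_substitution:
  fixes f :: "real \<Rightarrow> ennreal"
  assumes [measurable]: "f \<in> borel_measurable borel"
  shows "(\<integral>\<^sup>+x. f x * indicator {0<..} x \<partial>lborel) =
    (\<integral>\<^sup>+u. f (u\<^sup>2) * ennreal (2 * u) * indicator {0<..} u \<partial>lborel)"
proof -
  let ?L = "\<lambda>n::nat. \<lambda>x. f x * indicator {0..(real (Suc n))\<^sup>2} x"
  let ?R = "\<lambda>n::nat. \<lambda>u. f (u\<^sup>2) * ennreal (2 * u) * indicator {0..real (Suc n)} u"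
  have eq: "(\<integral>\<^sup>+x. ?L n x \<partial>lborel) = (\<integral>\<^sup>+u. ?R n u \<partial>lborel)" for n
  proof -
    have "((\<lambda>u. u\<^sup>2) has_real_derivative 2 * x) (at x)" for x :: real
      by (auto intro!: derivative_eq_intros)
    then show ?thesis
      using nn_integral_substitution_aux[of f 0 "real (Suc n)" "\<lambda>u. u\<^sup>2" "\<lambda>u. 2 * u"]
      by (simp add: continuous_intros)
  qed
  have "(\<integral>\<^sup>+x. f x * indicator {0<..} x \<partial>lborel) = (\<integral>\<^sup>+x. f x * indicator {0..} x \<partial>lborel)"
    using AE_lborel_singleton[of 0] by (intro nn_integral_cong_AE) (auto split: split_indicator)
  also have "\<dots> = (\<integral>\<^sup>+x. (SUP n. ?L n x) \<partial>lborel)"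
  proof (rule nn_integral_cong)
    fix x :: real
    show "f x * indicator {0..} x = (SUP n. ?L n x)"
    proof (cases "x \<ge> 0")
      case True
      obtain n :: nat where n: "x \<le> real n" using real_arch_simple by blast
      have "x \<le> (real (Suc n))\<^sup>2" using n by (simp add: power2_eq_square algebra_simps) (smt (verit) mult_nonneg_nonneg of_nat_0_le_iff)
      then have "f x \<le> (SUP n. ?L n x)"
        using True by (intro SUP_upper2[of n]) auto
      moreover have "(SUP n. ?L n x) \<le> f x"
        by (intro SUP_least) (auto split: split_indicator)
      ultimately show ?thesis using True by simp
    qed simp
  qed
  also have "\<dots> = (SUP n. \<integral>\<^sup>+x. ?L n x \<partial>lborel)"
  proof (rule nn_integral_monotone_convergence_SUP)
    show "incseq ?L"
    proof (intro monoI le_funI)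
      fix m n :: nat and x :: real
      assume "m \<le> n"
      then have "(real (Suc m))\<^sup>2 \<le> (real (Suc n))\<^sup>2" by (intro power_mono) auto
      from order_trans[OF _ this, of x] show "?L m x \<le> ?L n x"
        by (auto split: split_indicator simp del: of_nat_Suc)
    qed
  qed measurable
  also have "\<dots> = (SUP n. \<integral>\<^sup>+u. ?R n u \<partial>lborel)" by (simp only: eq)
  also have "\<dots> = (\<integral>\<^sup>+u. (SUP n. ?R n u) \<partial>lborel)"
    by (rule nn_integral_monotone_convergence_SUP[symmetric])
       (auto simp: incseq_def le_fun_def split: split_indicator)
  also have "\<dots> = (\<integral>\<^sup>+u. f (u\<^sup>2) * ennreal (2 * u) * indicator {0<..} u \<partial>lborel)"
  proof (rule nn_integral_cong)
    fix u :: real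
    show "(SUP n. ?R n u) = f (u\<^sup>2) * ennreal (2 * u) * indicator {0<..} u"
    proof (cases "u > 0")
      case True
      obtain n :: nat where n: "u \<le> real n" using real_arch_simple by blast
      have "f (u\<^sup>2) * ennreal (2 * u) \<le> (SUP n. ?R n u)"
        using True n by (intro SUP_upper2[of n]) auto
      moreover have "(SUP n. ?R n u) \<le> f (u\<^sup>2) * ennreal (2 * u)"
        by (intro SUP_least) (auto split: split_indicator)
      ultimately show ?thesis using True by simp
    next
      case False
      then have zero: "(\<lambda>n. ?R n u) = (\<lambda>n. 0)" by (cases "u = 0") auto
      show ?thesis unfolding zero using False by simp
    qed
  qed
  finally show ?thesis .
qed

section \<open>The kernels of the meander and of the process\<close>

lemma killed_kernel_nonneg:
  assumes "t \<ge> 0"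
  shows "killed_kernel t y z \<ge> 0"
proof -
  have "- (y + z)\<^sup>2 / (2 * t) \<le> - (y - z)\<^sup>2 / (2 * t)" if "y > 0" "z > 0"
    using that assms by (intro divide_right_mono) (auto simp: power2_eq_square algebra_simps)
  then show ?thesis using assms by (auto simp: killed_kernel_def)
qed

lemma killed_kernel_measurable [measurable]:
  assumes [measurable]: "f \<in> borel_measurable M" "g \<in> borel_measurable M"
  shows "(\<lambda>x. killed_kernel t (f x) (g x)) \<in> borel_measurable M"
  unfolding killed_kernel_def by measurable

lemma killed_survival_measurable [measurable]:
  "killed_survival u \<in> borel_measurable borel"
proof -
  have "(\<lambda>y. LINT w:{0<..}|lborel. killed_kernel u y w) \<in> borel_measurable borel"
    unfolding set_lebesgue_integral_def by measurable
  then show ?thesis unfolding killed_survival_def[abs_def] by measurable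
qed

lemma killed_survival_nonneg: "u \<ge> 0 \<Longrightarrow> killed_survival u y \<ge> 0"
  by (auto simp: killed_survival_def set_lebesgue_integral_def killed_kernel_nonneg intro!: Bochner_Integration.integral_nonneg)

lemma meander_entrance_measurable [measurable]: "meander_entrance t \<in> borel_measurable borel"
  unfolding meander_entrance_def[abs_def] by measurable

lemma meander_entrance_nonneg: "t \<ge> 0 \<Longrightarrow> meander_entrance t y \<ge> 0"
  by (auto simp: meander_entrance_def)

lemma killed_survival_support: "y \<le> 0 \<Longrightarrow> killed_survival u y = 0"
  by (simp add: killed_survival_def killed_kernel_def set_lebesgue_integral_def)

lemma trans_density_nonneg: "t \<ge> 0 \<Longrightarrow> x \<ge> 0 \<Longrightarrow> y \<ge> 0 \<Longrightarrow> trans_density t x y \<ge> 0"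
  by (auto simp: trans_density_def)

lemma trans_density_measurable [measurable]:
  assumes [measurable]: "f \<in> borel_measurable M" "g \<in> borel_measurable M"
  shows "(\<lambda>x. trans_density t (f x) (g x)) \<in> borel_measurable M"
  unfolding trans_density_def by measurable

text \<open>
  The difference of the Cauchy densities \<open>\<sigma> / (\<pi> (w\<^sup>2 + \<sigma>\<^sup>2))\<close> at \<open>w = u - v\<close> and at
  \<open>w = u + v\<close>, brought to a common denominator: the Cauchy semigroup acting on odd functions.
\<close>
definition odd_cauchy :: "real \<Rightarrow> real \<Rightarrow> real \<Rightarrow> real" where
  "odd_cauchy \<sigma> u v =
     (if u > 0 \<and> v > 0
      then 4 * \<sigma> * u * v / (pi * (((u - v)\<^sup>2 + \<sigma>\<^sup>2) * ((u + v)\<^sup>2 + \<sigma>\<^sup>2)))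
      else 0)"

lemma odd_cauchy_nonneg: "\<sigma> \<ge> 0 \<Longrightarrow> odd_cauchy \<sigma> u v \<ge> 0"
  by (auto simp: odd_cauchy_def)

lemma odd_cauchy_measurable [measurable]:
  assumes [measurable]: "f \<in> borel_measurable M" "g \<in> borel_measurable M"
  shows "(\<lambda>x. odd_cauchy \<sigma> (f x) (g x)) \<in> borel_measurable M"
  unfolding odd_cauchy_def by measurable

section \<open>Sine representations of the Brownian kernels\<close>

lemma gaussian_integrable:
  assumes "t > 0"
  shows "integrable lborel (\<lambda>u::real. exp (- t * u\<^sup>2 / 2))"
proof -
  have "integrable lborel (\<lambda>u. normal_density 0 (1 / sqrt t) u * (sqrt (2 * pi * (1 / sqrt t)\<^sup>2)))"
    using assms by (intro integrable_mult_left integrable_normal_density) auto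
  then show ?thesis
    using assms by (simp add: normal_density_def field_simps)
qed

lemma gaussian_moment_integrable:
  assumes "t > 0"
  shows "integrable lborel (\<lambda>u::real. \<bar>u\<bar> * exp (- t * u\<^sup>2 / 2))"
proof -
  have "integrable lborel (\<lambda>u. normal_density 0 (1 / sqrt t) u * \<bar>u - 0\<bar> ^ 1 * (sqrt (2 * pi * (1 / sqrt t)\<^sup>2)))"
    using assms by (intro integrable_mult_left integrable_normal_moment_abs) auto
  then show ?thesis
    using assms by (simp add: normal_density_def field_simps)
qed

lemma exponential_integrable:
  assumes "c > 0"
  shows "integrable lborel (\<lambda>y::real. exp (- c * y) * indicator {0<..} y)"
  using integrable_I0i_exp_mscale[OF assms] by (simp add: set_integrable_def mult_ac)

text \<open>
  Up to normalization and scaling by \<open>sqrt t\<close>, this is half of the characteristic function of the standard normal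
  distribution, because the integrand is even.
\<close>
lemma gaussian_cosine:
  assumes t: "t > 0"
  shows "(\<integral>u. cos (u * z) * (exp (- t * u\<^sup>2 / 2) * indicator {0<..} u) \<partial>lborel) =
    sqrt (pi / (2 * t)) * exp (- z\<^sup>2 / (2 * t))"
proof -
  define f where "f = (\<lambda>u. cos (u * z) * exp (- t * u\<^sup>2 / 2))"
  have f_int: "integrable lborel f"
    unfolding f_def by (rule Bochner_Integration.integrable_bound[OF gaussian_integrable[OF t]]) (auto simp: abs_mult)
  define w where "w = z / sqrt t"
  have "Re (char std_normal_distribution w) = (\<integral>x. cos (w * x) * std_normal_density x \<partial>lborel)"
  proof -
    have "integrable std_normal_distribution (\<lambda>x. iexp (w * x))"
      by (rule prob_space.integrable_iexp) (auto intro: prob_space_normal_density)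
    then have "Re (char std_normal_distribution w) = (\<integral>x. cos (w * x) \<partial>std_normal_distribution)"
      by (simp add: char_def Re_exp flip: integral_Re) 
    also have "\<dots> = (\<integral>x. cos (w * x) * std_normal_density x \<partial>lborel)"
      by (subst integral_density) (auto simp: normal_density_nonneg mult.commute)
    finally show ?thesis .
  qed
  then have "exp (- w\<^sup>2 / 2) = (\<integral>x. cos (w * x) * std_normal_density x \<partial>lborel)"
    by (simp add: char_std_normal_distribution)
  also have "\<dots> = sqrt t * (\<integral>x. cos (w * (0 + sqrt t * x)) * std_normal_density (0 + sqrt t * x) \<partial>lborel)"
    using t by (subst lborel_integral_real_affine[where c = "sqrt t" and t = 0]) auto
  also have "(\<lambda>x. cos (w * (0 + sqrt t * x)) * std_normal_density (0 + sqrt t * x)) = (\<lambda>x. 1 / sqrt (2 * pi) * f x)"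
    using t by (auto simp: w_def f_def std_normal_density_def power_mult_distrib mult_ac)
  finally have full: "(\<integral>u. f u \<partial>lborel) = sqrt (2 * pi) / sqrt t * exp (- z\<^sup>2 / (2 * t))"
    using t by (simp add: w_def power_divide field_simps)
  have "integrable lborel (\<lambda>x. indicator {0..} x *\<^sub>R f x)"
    by (rule Bochner_Integration.integrable_bound[OF f_int])
       (use f_int in \<open>auto split: split_indicator dest: borel_measurable_integrable\<close>)
  then have "has_bochner_integral lborel f (2 *\<^sub>R (\<integral>x. indicator {0..} x *\<^sub>R f x \<partial>lborel))"
    by (intro has_bochner_integral_even_function has_bochner_integral_integrable) (auto simp: f_def)
  then have "(\<integral>u. f u \<partial>lborel) = 2 * (\<integral>x. indicator {0..} x * f x \<partial>lborel)"
    by (auto dest: has_bochner_integral_integral_eq)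
  also have "(\<integral>x. indicator {0..} x * f x \<partial>lborel) = (\<integral>x. f x * indicator {0<..} x \<partial>lborel)"
    using AE_lborel_singleton[of 0] f_int
    by (intro integral_cong_AE) (auto split: split_indicator dest: borel_measurable_integrable)
  finally have "(\<integral>x. f x * indicator {0<..} x \<partial>lborel) = sqrt (2 * pi) / (2 * sqrt t) * exp (- z\<^sup>2 / (2 * t))"
    using full by simp
  also have "sqrt (2 * pi) / (2 * sqrt t) = sqrt (pi / (2 * t))"
    using t by (simp add: real_sqrt_mult real_sqrt_divide field_simps)
  finally show ?thesis by (simp add: f_def mult_ac)
qed

text \<open>
  The product of the two sines is half the difference of two cosines, and each of these contributes
  one of the two Gaussian terms of the kernel.
\<close>
lemma killed_kernel_sine:
  assumes t: "t > 0" and "y > 0" "z > 0"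
  shows "killed_kernel t y z =
    2 / pi * (\<integral>u. sin (u * z) * (sin (u * y) * exp (- t * u\<^sup>2 / 2) * indicator {0<..} u) \<partial>lborel)"
proof -
  let ?G = "\<lambda>u::real. exp (- t * u\<^sup>2 / 2) * indicator {0<..} u"
  have int: "integrable lborel (\<lambda>u. cos (u * a) * ?G u)" for a
    by (rule Bochner_Integration.integrable_bound[OF gaussian_integrable[OF t]])
       (auto simp: abs_mult split: split_indicator)
  have "(\<integral>u. sin (u * z) * (sin (u * y) * exp (- t * u\<^sup>2 / 2) * indicator {0<..} u) \<partial>lborel) =
    (\<integral>u. (cos (u * (y - z)) * ?G u - cos (u * (y + z)) * ?G u) / 2 \<partial>lborel)"
    by (rule Bochner_Integration.integral_cong)
       (auto simp: algebra_simps cos_add cos_diff)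
  also have "\<dots> = sqrt (pi / (2 * t)) * (exp (- (y - z)\<^sup>2 / (2 * t)) - exp (- (y + z)\<^sup>2 / (2 * t))) / 2"
    by (simp only: integral_divide_zero Bochner_Integration.integral_diff[OF int int] gaussian_cosine[OF t])
       (simp only: right_diff_distrib)
  also have "2 / pi * \<dots> = killed_kernel t y z"
  proof -
    have "2 / pi * (sqrt (pi / (2 * t)) / 2) = 1 / sqrt (2 * pi * t)"
      using t by (simp add: real_sqrt_mult real_sqrt_divide field_simps)
    then have "2 / pi * (sqrt (pi / (2 * t)) * D / 2) = 1 / sqrt (2 * pi * t) * D" for D
      by (metis mult.assoc mult.commute times_divide_eq_right)
    then show ?thesis using assms by (simp only: killed_kernel_def if_P simp_thms)
  qed
  finally show ?thesis ..
qed

lemma gaussian_tendsto: "t > 0 \<Longrightarrow> ((\<lambda>u::real. exp (- t * u\<^sup>2 / 2)) \<longlongrightarrow> 0) at_top"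
  by real_asymp

text \<open>
  Integration by parts: the factor \<open>u exp (- t u\<^sup>2 / 2)\<close> is a derivative, and what remains is a
  Gaussian cosine integral.
\<close>
lemma meander_entrance_sine:
  assumes t: "t > 0" and y: "y > 0"
  shows "meander_entrance t y =
    1 / pi * (\<integral>u. sin (u * y) * (u * exp (- t * u\<^sup>2 / 2) * indicator {0<..} u) \<partial>lborel)"
proof -
  let ?E = "\<lambda>u::real. exp (- t * u\<^sup>2 / 2)"
  let ?f = "\<lambda>u. u * ?E u * sin (u * y) - y / t * (cos (u * y) * ?E u)"
  have i1: "integrable lborel (\<lambda>u. sin (u * y) * (u * ?E u * indicator {0<..} u))"
    by (rule Bochner_Integration.integrable_bound[OF gaussian_moment_integrable[OF t]])
       (auto simp: abs_mult indicator_def intro!: AE_I2 mult_left_le_one_le mult_nonpos_nonneg)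
  have i2: "integrable lborel (\<lambda>u. cos (u * y) * (?E u * indicator {0<..} u))"
    by (rule Bochner_Integration.integrable_bound[OF gaussian_integrable[OF t]])
       (auto simp: abs_mult split: split_indicator)
  have split: "?f u * indicator {0<..} u = sin (u * y) * (u * ?E u * indicator {0<..} u) -
      y / t * (cos (u * y) * (?E u * indicator {0<..} u))" for u
    by (auto split: split_indicator)
  have "(\<integral>u. ?f u * indicator {0<..} u \<partial>lborel) = 0 - (- 1 / t * ?E 0 * sin (0 * y))"
  proof (rule half_line_FTC[where G = "\<lambda>u. - 1 / t * ?E u * sin (u * y)"])
    show "((\<lambda>u. - 1 / t * ?E u * sin (u * y)) has_real_derivative ?f u) (at u)" for u
      using t by (auto intro!: derivative_eq_intros simp: field_simps)
    show "integrable lborel (\<lambda>x. ?f x * indicator {0<..} x)"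
      unfolding split using i1 i2 by (intro Bochner_Integration.integrable_diff integrable_mult_right) auto
    have "((\<lambda>u. 1 / t * ?E u) \<longlongrightarrow> 0) at_top"
      using tendsto_mult_right[OF gaussian_tendsto[OF t], of "1/t"] by simp
    then show "((\<lambda>u. - 1 / t * ?E u * sin (u * y)) \<longlongrightarrow> 0) at_top"
      by (rule Lim_null_comparison[rotated]) (use t in \<open>auto simp: abs_mult divide_simps intro!: always_eventually\<close>)
  qed (intro continuous_intros, simp_all)
  then have "(\<integral>u. sin (u * y) * (u * ?E u * indicator {0<..} u) \<partial>lborel) = 
      y / t * (\<integral>u. cos (u * y) * (?E u * indicator {0<..} u) \<partial>lborel)"
    unfolding split using i1 i2 by (subst (asm) Bochner_Integration.integral_diff) auto
  also have "\<dots> = y / t * (sqrt (pi / (2 * t)) * exp (- y\<^sup>2 / (2 * t)))"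
    using gaussian_cosine[OF t] by simp
  also have "1 / pi * \<dots> = meander_entrance t y"
  proof -
    have "1 / pi * (1 / t * sqrt (pi / (2 * t))) = 1 / sqrt (2 * pi * t ^ 3)"
      using t by (simp add: real_sqrt_mult real_sqrt_divide power3_eq_cube field_simps)
    moreover have "1 / pi * (y / t * (S * D)) = 1 / pi * (1 / t * S) * y * D" for S D
      by simp
    ultimately have "1 / pi * (y / t * (sqrt (pi / (2 * t)) * D)) = 1 / sqrt (2 * pi * t ^ 3) * y * D" for D
      by presburger
    then show ?thesis using y by (simp only: meander_entrance_def if_True)
  qed
  finally show ?thesis ..
qed

text \<open>
  A translation turns both terms of the kernel into tails of one centred Gaussian, which start at
  \<open>- y\<close> and at \<open>y\<close>.
\<close>
lemma killed_survival_gaussian: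
  assumes t: "t > 0" and y: "y > 0"
  shows "killed_survival t y = 1 / sqrt (2 * pi * t) * (\<integral>z. indicator {-y<..y} z * exp (- z\<^sup>2 / (2 * t)) \<partial>lborel)"
proof -
  define c where "c = 1 / sqrt (2 * pi * t)"
  define G where "G = (\<lambda>z. exp (- z\<^sup>2 / (2 * t)))"
  have [measurable]: "G \<in> borel_measurable borel" unfolding G_def by simp
  have G_int: "integrable lborel G"
    using gaussian_integrable[of "1 / t"] t by (simp add: G_def field_simps)
  have shift: "(\<integral>w. G (a + w) * indicator {0<..} w \<partial>lborel) = (\<integral>x. G x * indicator {a<..} x \<partial>lborel)"
    and shift_int: "integrable lborel (\<lambda>w. G (a + w) * indicator {0<..} w)" for a
  proof -
    have eq: "(\<lambda>w. G (a + w) * indicator {0<..} w) = (\<lambda>w. G (a + 1 * w) * indicator {a<..} (a + 1 * w))"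
      by (auto split: split_indicator)
    show "(\<integral>w. G (a + w) * indicator {0<..} w \<partial>lborel) = (\<integral>x. G x * indicator {a<..} x \<partial>lborel)"
      unfolding eq by (subst (2) lborel_integral_real_affine[where c = 1 and t = a]) auto
    show "integrable lborel (\<lambda>w. G (a + w) * indicator {0<..} w)"
      unfolding eq by (rule lborel_integrable_real_affine)
        (rule integrable_real_mult_indicator, use G_int in auto)
  qed
  have ind_int: "integrable lborel (\<lambda>x. G x * indicator {a<..} x)" for a
    by (rule integrable_real_mult_indicator) (use G_int in auto)
  have "killed_survival t y = (\<integral>w. c * (G (- y + w) * indicator {0<..} w - G (y + w) * indicator {0<..} w) \<partial>lborel)"
    unfolding killed_survival_def set_lebesgue_integral_def
    using t y by (auto simp: killed_kernel_def c_def G_def power2_commute algebra_simps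
        intro!: Bochner_Integration.integral_cong split: split_indicator)
  also have "\<dots> = c * (\<integral>x. G x * indicator {-y<..} x - G x * indicator {y<..} x \<partial>lborel)"
    using shift_int ind_int by (simp only: integral_mult_right_zero Bochner_Integration.integral_diff shift)
  also have "\<dots> = c * (\<integral>z. indicator {-y<..y} z * G z \<partial>lborel)"
    using y by (intro arg_cong2[where f = times] Bochner_Integration.integral_cong)
      (auto split: split_indicator)
  finally show ?thesis unfolding c_def G_def .
qed

lemma killed_survival_le_1:
  assumes t: "t \<ge> 0"
  shows "killed_survival t y \<le> 1"
proof (cases "t > 0 \<and> y > 0")
  case True
  then have "killed_survival t y = (\<integral>z. indicator {-y<..y} z * normal_density 0 (sqrt t) z \<partial>lborel)"
    by (simp add: killed_survival_gaussian normal_density_def flip: integral_mult_right_zero)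
  also have "\<dots> \<le> (\<integral>z. normal_density 0 (sqrt t) z \<partial>lborel)"
  proof (rule integral_mono)
    show "integrable lborel (\<lambda>z. indicator {-y<..y} z * normal_density 0 (sqrt t) z)"
      using True integrable_real_mult_indicator[OF _ integrable_normal_density, of "{-y<..y}" "sqrt t" 0]
      by (simp add: mult.commute)
    show "integrable lborel (normal_density 0 (sqrt t))"
      using True by (intro integrable_normal_density) auto
    show "indicator {-y<..y} z * normal_density 0 (sqrt t) z \<le> normal_density 0 (sqrt t) z" for z
      by (simp add: normal_density_nonneg split: split_indicator)
  qed
  finally show ?thesis using True by (simp add: integral_normal_density)
next
  case False
  then show ?thesis using t
    by (auto simp: killed_survival_def killed_kernel_def set_lebesgue_integral_def split: split_indicator)
qed

text \<open>
  Obtained by integrating the cosine representation of the Gaussian over \<open>{- y<..y}\<close>, where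
  \<open>cos (u z)\<close> integrates to \<open>2 sin (u y) / u\<close>.
\<close>
lemma killed_survival_sinc:
  assumes t: "t > 0" and y: "y > 0"
  shows "killed_survival t y =
    2 / pi * (\<integral>u. sin (u * y) / u * (exp (- t * u\<^sup>2 / 2) * indicator {0<..} u) \<partial>lborel)"
proof -
  have "killed_survival t y = 1 / sqrt (2 * pi * t) * (\<integral>z. indicator {-y<..y} z * exp (- z\<^sup>2 / (2 * t)) \<partial>lborel)"
    by (rule killed_survival_gaussian[OF t y])
  also have "\<dots> = 1 / pi * (\<integral>z. indicator {-y<..y} z *
      (\<integral>u. cos (u * z) * (exp (- t * u\<^sup>2 / 2) * indicator {0<..} u) \<partial>lborel) \<partial>lborel)"
  proof -
    have "1 / sqrt (2 * pi * t) = 1 / pi * sqrt (pi / (2 * t))"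
      using t by (simp add: real_sqrt_mult real_sqrt_divide field_simps)
    then show ?thesis
      unfolding gaussian_cosine[OF t] by (simp flip: integral_mult_right_zero add: mult_ac)
  qed
  also have "(\<integral>z. indicator {-y<..y} z *
      (\<integral>u. cos (u * z) * (exp (- t * u\<^sup>2 / 2) * indicator {0<..} u) \<partial>lborel) \<partial>lborel) =
    (\<integral>u. exp (- t * u\<^sup>2 / 2) * indicator {0<..} u * (\<integral>z. cos (u * z) * indicator {-y<..y} z \<partial>lborel) \<partial>lborel)"
    using integrable_real_mult_indicator[OF _ gaussian_integrable[OF t], of "{0<..}"] y
    by (intro bounded_kernel_Fubini(1)) auto
  also have "\<dots> = (\<integral>u. 2 * (sin (u * y) / u * (exp (- t * u\<^sup>2 / 2) * indicator {0<..} u)) \<partial>lborel)"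
  proof (rule Bochner_Integration.integral_cong)
    fix u :: real
    have "(\<integral>z. cos (u * z) * indicator {-y<..y} z \<partial>lborel) = 2 * (sin (u * y) / u)" if u: "u > 0"
    proof -
      have "(\<integral>z. cos (u * z) * indicator {-y<..y} z \<partial>lborel) = (\<integral>z. cos (u * z) * indicator {-y..y} z \<partial>lborel)"
        using AE_lborel_singleton[of "-y"]
        by (intro integral_cong_AE) (auto split: split_indicator)
      also have "\<dots> = sin (u * y) / u - sin (u * (- y)) / u"
        using y u by (intro integral_FTC_Icc_real) (auto intro!: derivative_eq_intros)
      finally show ?thesis by simp
    qed
    then show "exp (- t * u\<^sup>2 / 2) * indicator {0<..} u * (\<integral>z. cos (u * z) * indicator {-y<..y} z \<partial>lborel) =
        2 * (sin (u * y) / u * (exp (- t * u\<^sup>2 / 2) * indicator {0<..} u))"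
      by (auto split: split_indicator)
  qed simp
  also have "\<dots> = 2 * (\<integral>u. sin (u * y) / u * (exp (- t * u\<^sup>2 / 2) * indicator {0<..} u) \<partial>lborel)"
    by (rule integral_mult_right_zero)
  finally show ?thesis by (simp only: mult.assoc mult.left_commute times_divide_eq_left mult_1)
qed

section \<open>Sine representation of the killed Cauchy kernel\<close>

lemma laplace_cosine:
  fixes a c :: real
  assumes c: "c > 0"
  shows "(\<integral>y. cos (a * y) * (exp (- c * y) * indicator {0<..} y) \<partial>lborel) = c / (c\<^sup>2 + a\<^sup>2)"
    and "integrable lborel (\<lambda>y. cos (a * y) * (exp (- c * y) * indicator {0<..} y))"
proof -
  let ?G = "\<lambda>y. exp (- c * y) * (a * sin (a * y) - c * cos (a * y)) / (c\<^sup>2 + a\<^sup>2)"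
  have nz: "c\<^sup>2 + a\<^sup>2 > 0" using c by (intro add_pos_nonneg) auto
  show int: "integrable lborel (\<lambda>y. cos (a * y) * (exp (- c * y) * indicator {0<..} y))"
    by (rule Bochner_Integration.integrable_bound[OF exponential_integrable[OF c]])
       (auto simp: abs_mult split: split_indicator)
  have "(\<integral>y. cos (a * y) * exp (- c * y) * indicator {0<..} y \<partial>lborel) = 0 - ?G 0"
  proof (rule half_line_FTC)
    have "((\<lambda>y. exp (- c * y) * (a * sin (a * y) - c * cos (a * y))) has_real_derivative
        cos (a * y) * exp (- c * y) * (c\<^sup>2 + a\<^sup>2)) (at y)" for y
      by (auto intro!: derivative_eq_intros simp: algebra_simps power2_eq_square)
    then show "(?G has_real_derivative cos (a * y) * exp (- c * y)) (at y)" for y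
      by (rule DERIV_cong[OF DERIV_cdivide]) (simp only: nonzero_mult_div_cancel_right[OF less_imp_neq[OF nz, symmetric]])
    have "((\<lambda>y. exp (- c * y) * (\<bar>a\<bar> + c) / (c\<^sup>2 + a\<^sup>2)) \<longlongrightarrow> 0) at_top"
      using c by real_asymp
    then show "(?G \<longlongrightarrow> 0) at_top"
    proof (rule Lim_null_comparison[rotated], intro always_eventually allI)
      fix y
      have "\<bar>a * sin (a * y) - c * cos (a * y)\<bar> \<le> \<bar>a * sin (a * y)\<bar> + \<bar>c * cos (a * y)\<bar>"
        by (rule abs_triangle_ineq4)
      also have "\<dots> \<le> \<bar>a\<bar> + c"
        using c by (auto simp: abs_mult intro!: add_mono mult_left_le)
      finally show "norm (?G y) \<le> exp (- c * y) * (\<bar>a\<bar> + c) / (c\<^sup>2 + a\<^sup>2)"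
        using nz by (auto simp: abs_mult intro!: divide_right_mono)
    qed
  qed (use int in \<open>auto simp: mult_ac\<close>)
  then show "(\<integral>y. cos (a * y) * (exp (- c * y) * indicator {0<..} y) \<partial>lborel) = c / (c\<^sup>2 + a\<^sup>2)"
    by (simp add: mult.assoc)
qed

lemma laplace_sine:
  fixes a c :: real
  assumes c: "c > 0"
  shows "(\<integral>y. sin (a * y) * (exp (- c * y) * indicator {0<..} y) \<partial>lborel) = a / (c\<^sup>2 + a\<^sup>2)"
proof -
  let ?G = "\<lambda>y. - exp (- c * y) * (c * sin (a * y) + a * cos (a * y)) / (c\<^sup>2 + a\<^sup>2)"
  have nz: "c\<^sup>2 + a\<^sup>2 > 0" using c by (intro add_pos_nonneg) auto
  have int: "integrable lborel (\<lambda>y. sin (a * y) * (exp (- c * y) * indicator {0<..} y))"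
    by (rule Bochner_Integration.integrable_bound[OF exponential_integrable[OF c]])
       (auto simp: abs_mult split: split_indicator)
  have "(\<integral>y. sin (a * y) * exp (- c * y) * indicator {0<..} y \<partial>lborel) = 0 - ?G 0"
  proof (rule half_line_FTC)
    have "((\<lambda>y. - exp (- c * y) * (c * sin (a * y) + a * cos (a * y))) has_real_derivative
        sin (a * y) * exp (- c * y) * (c\<^sup>2 + a\<^sup>2)) (at y)" for y
      by (auto intro!: derivative_eq_intros simp: algebra_simps power2_eq_square)
    then show "(?G has_real_derivative sin (a * y) * exp (- c * y)) (at y)" for y
      by (rule DERIV_cong[OF DERIV_cdivide]) (simp only: nonzero_mult_div_cancel_right[OF less_imp_neq[OF nz, symmetric]])
    have "((\<lambda>y. exp (- c * y) * (c + \<bar>a\<bar>) / (c\<^sup>2 + a\<^sup>2)) \<longlongrightarrow> 0) at_top"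
      using c by real_asymp
    then show "(?G \<longlongrightarrow> 0) at_top"
    proof (rule Lim_null_comparison[rotated], intro always_eventually allI)
      fix y
      have "\<bar>c * sin (a * y) + a * cos (a * y)\<bar> \<le> \<bar>c * sin (a * y)\<bar> + \<bar>a * cos (a * y)\<bar>"
        by (rule abs_triangle_ineq)
      also have "\<dots> \<le> c + \<bar>a\<bar>"
        using c by (auto simp: abs_mult intro!: add_mono mult_left_le)
      finally show "norm (?G y) \<le> exp (- c * y) * (c + \<bar>a\<bar>) / (c\<^sup>2 + a\<^sup>2)"
        using nz by (auto simp: abs_mult intro!: divide_right_mono)
    qed
  qed (use int in \<open>auto simp: mult_ac\<close>)
  then show ?thesis by (simp add: mult.assoc)
qed

text \<open>
  As for the Brownian kernel, the product of sines becomes a difference of cosines; their Laplace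
  transforms are the two Cauchy densities.
\<close>
lemma odd_cauchy_sine:
  assumes s: "\<sigma> > 0" and "u > 0" "v > 0"
  shows "odd_cauchy \<sigma> u v =
    2 / pi * (\<integral>y. sin (u * y) * (sin (v * y) * exp (- \<sigma> * y) * indicator {0<..} y) \<partial>lborel)"
proof -
  let ?E = "\<lambda>y::real. exp (- \<sigma> * y) * indicator {0<..} y"
  let ?A = "\<sigma>\<^sup>2 + (u - v)\<^sup>2" and ?B = "\<sigma>\<^sup>2 + (u + v)\<^sup>2"
  have "(\<integral>y. sin (u * y) * (sin (v * y) * exp (- \<sigma> * y) * indicator {0<..} y) \<partial>lborel) =
    (\<integral>y. (cos ((u - v) * y) * ?E y - cos ((u + v) * y) * ?E y) / 2 \<partial>lborel)"
    by (rule Bochner_Integration.integral_cong)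
       (auto simp: algebra_simps cos_add cos_diff)
  also have "\<dots> = (\<sigma> / ?A - \<sigma> / ?B) / 2"
    by (simp only: integral_divide_zero
        Bochner_Integration.integral_diff[OF laplace_cosine(2) laplace_cosine(2), OF s s] laplace_cosine(1)[OF s])
  also have "2 / pi * \<dots> = odd_cauchy \<sigma> u v"
  proof -
    have "?A > 0" "?B > 0" using s by (auto simp: add_pos_nonneg)
    then have "\<sigma> / ?A - \<sigma> / ?B = \<sigma> * (?B - ?A) / (?A * ?B)"
      by (subst diff_frac_eq) (auto simp only: right_diff_distrib)
    also have "?B - ?A = 4 * u * v" by (simp add: power2_eq_square algebra_simps)
    finally show ?thesis using assms by (simp add: odd_cauchy_def add.commute mult_ac)
  qed
  finally show ?thesis ..
qed

text \<open>
  The denominator of the transition density factorizes in the square roots of its arguments. The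
  factor \<open>2 u\<close> is the Jacobian of \<open>x = u\<^sup>2\<close>.
\<close>
lemma trans_density_square:
  assumes "u > 0" "v > 0"
  shows "trans_density \<sigma> (u\<^sup>2) (v\<^sup>2) * (2 * u) = odd_cauchy \<sigma> u v"
proof -
  have "(v\<^sup>2 - u\<^sup>2)\<^sup>2 + 2 * (u\<^sup>2 + v\<^sup>2) * \<sigma>\<^sup>2 + \<sigma> ^ 4 = ((u - v)\<^sup>2 + \<sigma>\<^sup>2) * ((u + v)\<^sup>2 + \<sigma>\<^sup>2)"
    by algebra
  then show ?thesis using assms
    by (simp add: trans_density_def odd_cauchy_def)
qed

text \<open>
  This is the formal sine representation with the survival probability \<open>1\<close>, that is, the Laplace
  transform of \<open>sin (v y)\<close>; as the representation is not absolutely convergent, an antiderivative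
  is used instead.
\<close>
lemma odd_cauchy_over_u_integral:
  assumes s: "\<sigma> > 0" and v: "v > 0"
  shows "(\<integral>\<^sup>+u. ennreal (odd_cauchy \<sigma> u v / u) \<partial>lborel) = ennreal (v / (\<sigma>\<^sup>2 + v\<^sup>2))"
proof -
  let ?f = "\<lambda>u. 4 * \<sigma> * v / (pi * (((u - v)\<^sup>2 + \<sigma>\<^sup>2) * ((u + v)\<^sup>2 + \<sigma>\<^sup>2)))"
  let ?K = "\<sigma> / (pi * (\<sigma>\<^sup>2 + v\<^sup>2))"
  \<comment> \<open>Partial fractions in \<open>u\<close>. The logarithms cancel at \<open>0\<close> and at infinity, so that only the values of \<open>arctan\<close> at infinity contribute.\<close>
  let ?F = "\<lambda>u. ?K * ((ln ((u + v)\<^sup>2 + \<sigma>\<^sup>2) - ln ((u - v)\<^sup>2 + \<sigma>\<^sup>2)) / 2 +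
      v / \<sigma> * (arctan ((u - v) / \<sigma>) + arctan ((u + v) / \<sigma>)))"
  have pos: "(u - v)\<^sup>2 + \<sigma>\<^sup>2 > 0" "(u + v)\<^sup>2 + \<sigma>\<^sup>2 > 0" for u
    using s by (auto simp: add_nonneg_pos)
  have nz: "\<sigma>\<^sup>2 + v\<^sup>2 > 0" using s by (simp add: add_pos_nonneg)
  have "(\<integral>\<^sup>+u. ennreal (odd_cauchy \<sigma> u v / u) \<partial>lborel) =
      (\<integral>\<^sup>+u. ennreal (?f u) * indicator {0..} u \<partial>lborel)"
    using AE_lborel_singleton[of 0]
    by (intro nn_integral_cong_AE, eventually_elim)
       (use v in \<open>auto simp: odd_cauchy_def mult.assoc split: split_indicator\<close>)
  also have "\<dots> = ennreal (?K * ((0 / 2) + v / \<sigma> * (pi / 2 + pi / 2)) - ?F 0)"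
  proof (rule nn_integral_FTC_atLeast)
    fix u :: real
    have at1: "((\<lambda>u. arctan ((u - v) / \<sigma>)) has_real_derivative \<sigma> / ((u - v)\<^sup>2 + \<sigma>\<^sup>2)) (at u)"
      by (rule derivative_eq_intros refl | use s pos(1)[of u] in \<open>simp add: field_simps power2_eq_square\<close>)+
    have at2: "((\<lambda>u. arctan ((u + v) / \<sigma>)) has_real_derivative \<sigma> / ((u + v)\<^sup>2 + \<sigma>\<^sup>2)) (at u)"
      by (rule derivative_eq_intros refl | use s pos(2)[of u] in \<open>simp add: field_simps power2_eq_square\<close>)+
    have ln1: "((\<lambda>u. ln ((u - v)\<^sup>2 + \<sigma>\<^sup>2)) has_real_derivative 2 * (u - v) / ((u - v)\<^sup>2 + \<sigma>\<^sup>2)) (at u)"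
      by (rule derivative_eq_intros refl | use pos(1)[of u] in simp)+
    have ln2: "((\<lambda>u. ln ((u + v)\<^sup>2 + \<sigma>\<^sup>2)) has_real_derivative 2 * (u + v) / ((u + v)\<^sup>2 + \<sigma>\<^sup>2)) (at u)"
      by (rule derivative_eq_intros refl | use pos(2)[of u] in simp)+
    define a where "a = (u - v)\<^sup>2 + \<sigma>\<^sup>2"
    define b where "b = (u + v)\<^sup>2 + \<sigma>\<^sup>2"
    have ab: "a > 0" "b > 0" using pos by (auto simp: a_def b_def)
    \<comment> \<open>Here \<open>a - b = - 4 u v\<close>, which is what makes the numerator independent of \<open>u\<close>.\<close>
    have "(2 * (u + v) / b - 2 * (u - v) / a) / 2 + v / \<sigma> * (\<sigma> / a + \<sigma> / b) =
      ((u + 2 * v) * a - (u - 2 * v) * b) / (a * b)"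
      using ab s by (simp add: divide_simps) (simp add: algebra_simps)
    then have "?K * ((2 * (u + v) / b - 2 * (u - v) / a) / 2 + v / \<sigma> * (\<sigma> / a + \<sigma> / b)) =
      ?K * (((u + 2 * v) * a - (u - 2 * v) * b) / (a * b))"
      by (simp only:)
    also have "(u + 2 * v) * a - (u - 2 * v) * b = 4 * v * (\<sigma>\<^sup>2 + v\<^sup>2)"
      unfolding a_def b_def by algebra
    also have "?K * (4 * v * (\<sigma>\<^sup>2 + v\<^sup>2) / (a * b)) = ?f u"
    proof -
      have "\<sigma> / (pi * S) * (4 * v * S / (a * b)) = 4 * \<sigma> * v / (pi * (a * b))" if "S > 0" for S
        using that by simp
      from this[OF nz] show ?thesis unfolding a_def b_def .
    qed
    finally have eq: "?K * ((2 * (u + v) / b - 2 * (u - v) / a) / 2 + v / \<sigma> * (\<sigma> / a + \<sigma> / b)) = ?f u" .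
    show "(?F has_real_derivative ?f u) (at u)"
      unfolding eq[symmetric] a_def b_def
      by (intro DERIV_cmult DERIV_add DERIV_cdivide DERIV_diff at1 at2 ln1 ln2)
    show "0 \<le> ?f u" using s v by auto
  next
    have "((\<lambda>u. ln ((u + v)\<^sup>2 + \<sigma>\<^sup>2) - ln ((u - v)\<^sup>2 + \<sigma>\<^sup>2)) \<longlongrightarrow> 0) at_top"
      by real_asymp
    moreover have "((\<lambda>u. arctan ((u - v) / \<sigma>)) \<longlongrightarrow> pi / 2) at_top" "((\<lambda>u. arctan ((u + v) / \<sigma>)) \<longlongrightarrow> pi / 2) at_top"
      by (rule filterlim_compose[OF tendsto_arctan_at_top], use s in real_asymp)+
    ultimately show "(?F \<longlongrightarrow> ?K * (0 / 2 + v / \<sigma> * (pi / 2 + pi / 2))) at_top"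
      by (intro tendsto_intros) auto
  qed auto
  also have "?F 0 = 0"
    by (simp add: power2_commute arctan_minus[symmetric] del: arctan_minus) (simp add: arctan_minus)
  also have "?K * ((0 / 2) + v / \<sigma> * (pi / 2 + pi / 2)) - 0 = v / (\<sigma>\<^sup>2 + v\<^sup>2)"
  proof -
    have "\<sigma> / (pi * S) * ((0 / 2) + v / \<sigma> * (pi / 2 + pi / 2)) - 0 = v / S" if "S > 0" for S
      using s that by simp
    from this[OF nz] show ?thesis .
  qed
  finally show ?thesis .
qed

section \<open>The starting point of the duality\<close>

lemma survival_weight_integrable:
  assumes s: "\<sigma> > 0" and tau: "\<tau> \<ge> 0"
  shows "integrable lborel (\<lambda>y. exp (- \<sigma> * y) * killed_survival \<tau> y * indicator {0<..} y)"
proof (rule Bochner_Integration.integrable_bound[OF exponential_integrable[OF s]])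
  have "norm (exp (- \<sigma> * y) * killed_survival \<tau> y * indicator {0<..} y) \<le>
      norm (exp (- \<sigma> * y) * indicator {0<..} y)" for y
    using killed_survival_nonneg[OF tau, of y] killed_survival_le_1[OF tau, of y]
    by (cases "y > 0") (simp_all add: abs_mult mult_left_le)
  then show "AE y in lborel. norm (exp (- \<sigma> * y) * killed_survival \<tau> y * indicator {0<..} y) \<le>
      norm (exp (- \<sigma> * y) * indicator {0<..} y)"
    by simp
qed measurable

text \<open>
  This is the duality before the first transition. The weight \<open>1 / u\<close> would make the sine
  representation singular at \<open>0\<close>. It is moved into the kernel \<open>\<kappa> u y = sin (u y) / (u y)\<close>, bounded by
  \<open>1\<close>, at the price of a factor \<open>y\<close> that the exponential weight absorbs. For large \<open>u\<close> the Gaussian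
  factor is needed, so the case \<open>\<tau> = 0\<close> is computed separately. Nonnegativity of the sine integral is
  recorded because it allows passing between \<open>ennreal\<close> and \<open>real\<close> later on.
\<close>
lemma odd_cauchy_survival_integral:
  assumes s: "\<sigma> > 0" and v: "v > 0" and tau: "\<tau> \<ge> 0"
  shows "(\<integral>\<^sup>+u. ennreal (exp (- \<tau> * u\<^sup>2 / 2) / u * odd_cauchy \<sigma> u v) \<partial>lborel) =
    ennreal (\<integral>y. sin (v * y) * (exp (- \<sigma> * y) * killed_survival \<tau> y * indicator {0<..} y) \<partial>lborel)" (is ?identity)
    and "(\<integral>y. sin (v * y) * (exp (- \<sigma> * y) * killed_survival \<tau> y * indicator {0<..} y) \<partial>lborel) \<ge> 0" (is ?nonneg)
proof (atomize (full), cases "\<tau> = 0")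
  case True
  have "(\<integral>y. sin (v * y) * (exp (- \<sigma> * y) * killed_survival 0 y * indicator {0<..} y) \<partial>lborel) =
    (\<integral>y. sin (v * y) * (exp (- \<sigma> * y) * indicator {0<..} y) \<partial>lborel)"
    by (rule Bochner_Integration.integral_cong) (auto simp: killed_survival_def split: split_indicator)
  also have "\<dots> = v / (\<sigma>\<^sup>2 + v\<^sup>2)" by (rule laplace_sine[OF s])
  finally have transform: "(\<integral>y. sin (v * y) * (exp (- \<sigma> * y) * killed_survival 0 y * indicator {0<..} y) \<partial>lborel) =
    v / (\<sigma>\<^sup>2 + v\<^sup>2)" .
  show "?identity \<and> ?nonneg"
    unfolding True transform using odd_cauchy_over_u_integral[OF s v] v by auto
next
  case False
  then have t: "\<tau> > 0" using tau by simp
  define F where "F = (\<lambda>y. y * sin (v * y) * exp (- \<sigma> * y) * indicator {0<..} y)"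
  define H where "H = (\<lambda>u. exp (- \<tau> * u\<^sup>2 / 2) * indicator {0<..} u)"
  define \<kappa> where "\<kappa> = (\<lambda>u y::real. sin (u * y) / (u * y))"
  have F: "integrable lborel F"
  proof (rule Bochner_Integration.integrable_bound)
    show "integrable lborel (\<lambda>y. 2 / \<sigma> * (exp (- (\<sigma> / 2) * y) * indicator {0<..} y))"
      using exponential_integrable[of "\<sigma> / 2"] s by (intro integrable_mult_right) auto
    have "norm (F y) \<le> norm (2 / \<sigma> * (exp (- (\<sigma> / 2) * y) * indicator {0<..} y))" for y
    proof (cases "y > 0")
      case True
      have "\<sigma> / 2 * y \<le> exp (\<sigma> / 2 * y)" using exp_ge_add_one_self[of "\<sigma> / 2 * y"] by linarith
      then have "\<sigma> / 2 * y * exp (- \<sigma> * y) \<le> exp (\<sigma> / 2 * y) * exp (- \<sigma> * y)"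
        by (intro mult_right_mono) auto
      also have "\<dots> = exp (- (\<sigma> / 2) * y)" by (simp add: mult_exp_exp)
      finally have "y * exp (- \<sigma> * y) \<le> 2 / \<sigma> * exp (- (\<sigma> / 2) * y)"
        using s by (simp add: field_simps)
      moreover have "norm (F y) \<le> 1 * (y * exp (- \<sigma> * y))"
        using True mult_right_mono[of "\<bar>sin (v * y)\<bar>" 1 "y * exp (- \<sigma> * y)"]
        by (simp add: F_def abs_mult mult_ac)
      ultimately show ?thesis using True s by simp
    qed (simp add: F_def)
    then show "AE y in lborel. norm (F y) \<le> norm (2 / \<sigma> * (exp (- (\<sigma> / 2) * y) * indicator {0<..} y))"
      by simp
  qed (simp add: F_def)
  have H: "integrable lborel H"
    unfolding H_def by (rule integrable_real_mult_indicator) (use gaussian_integrable[OF t] in auto)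
  have \<kappa>_meas: "case_prod \<kappa> \<in> borel_measurable (borel \<Otimes>\<^sub>M borel)" unfolding \<kappa>_def by measurable
  have \<kappa>_bound: "\<bar>\<kappa> u y\<bar> \<le> 1" for u y
    using abs_sin_x_le_abs_x by (auto simp: \<kappa>_def divide_le_eq_1)
  note Fubini = bounded_kernel_Fubini[OF F H \<kappa>_meas \<kappa>_bound]
  have left: "exp (- \<tau> * u\<^sup>2 / 2) / u * odd_cauchy \<sigma> u v = 2 / pi * (H u * (\<integral>y. \<kappa> u y * F y \<partial>lborel))" for u
  proof (cases "u > 0")
    case True
    have "1 / u * (\<integral>y. sin (u * y) * (sin (v * y) * exp (- \<sigma> * y) * indicator {0<..} y) \<partial>lborel) =
       (\<integral>y. \<kappa> u y * F y \<partial>lborel)"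
      unfolding integral_mult_right_zero[symmetric]
      by (rule Bochner_Integration.integral_cong) (use True in \<open>auto simp: \<kappa>_def F_def split: split_indicator\<close>)
    then show ?thesis
      using True by (simp add: odd_cauchy_sine[OF s True v] H_def field_simps)
  qed (simp add: odd_cauchy_def H_def)
  have right: "sin (v * y) * (exp (- \<sigma> * y) * killed_survival \<tau> y * indicator {0<..} y) =
      2 / pi * (F y * (\<integral>u. \<kappa> u y * H u \<partial>lborel))" for y
  proof (cases "y > 0")
    case True
    have "(\<integral>u. sin (u * y) / u * (exp (- \<tau> * u\<^sup>2 / 2) * indicator {0<..} u) \<partial>lborel) =
      y * (\<integral>u. \<kappa> u y * H u \<partial>lborel)"
      unfolding integral_mult_right_zero[symmetric]
      by (rule Bochner_Integration.integral_cong) (use True in \<open>auto simp: \<kappa>_def H_def split: split_indicator\<close>)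
    then show ?thesis
      using True by (simp add: killed_survival_sinc[OF t True] F_def)
  qed (simp add: F_def)
  have nonneg: "exp (- \<tau> * u\<^sup>2 / 2) / u * odd_cauchy \<sigma> u v \<ge> 0" for u
    using s by (auto simp: odd_cauchy_def)
  have eq: "(\<integral>u. exp (- \<tau> * u\<^sup>2 / 2) / u * odd_cauchy \<sigma> u v \<partial>lborel) =
      (\<integral>y. sin (v * y) * (exp (- \<sigma> * y) * killed_survival \<tau> y * indicator {0<..} y) \<partial>lborel)"
    unfolding left right integral_mult_right_zero Fubini(1) ..
  have "integrable lborel (\<lambda>u. exp (- \<tau> * u\<^sup>2 / 2) / u * odd_cauchy \<sigma> u v)"
    unfolding left by (intro integrable_mult_right Fubini)
  then have ?identity
    using nonneg by (simp only: eq[symmetric] nn_integral_eq_integral AE_I2)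
  moreover have ?nonneg
    unfolding eq[symmetric] by (intro Bochner_Integration.integral_nonneg nonneg)
  ultimately show "?identity \<and> ?nonneg" ..
qed

section \<open>Damped sine transforms and one step of the kernels\<close>

text \<open>
  All functions are extended by \<open>0\<close> to the negative half-line, so that integrals can be taken over
  the whole line.
\<close>
definition damped_sine_transform :: "real \<Rightarrow> (real \<Rightarrow> real) \<Rightarrow> real \<Rightarrow> real" where
  "damped_sine_transform \<tau> F u =
     exp (- \<tau> * u\<^sup>2 / 2) * indicator {0<..} u * (\<integral>y. sin (u * y) * F y \<partial>lborel)"

lemma sine_kernel_measurable: "case_prod (\<lambda>u y. sin (u * y :: real)) \<in> borel_measurable (borel \<Otimes>\<^sub>M borel)"
  by measurable

lemma gaussian_half_line_integrable:
  "t > 0 \<Longrightarrow> integrable lborel (\<lambda>u::real. exp (- t * u\<^sup>2 / 2) * indicator {0<..} u)"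
  using gaussian_integrable by (intro integrable_real_mult_indicator) auto

lemma damped_sine_transform_integrable:
  assumes "\<tau> > 0" "integrable lborel F"
  shows "integrable lborel (damped_sine_transform \<tau> F)"
  unfolding damped_sine_transform_def[abs_def]
  using bounded_kernel_Fubini(2)[OF assms(2) gaussian_half_line_integrable[OF assms(1)] sine_kernel_measurable]
  by simp

text \<open>
  One half of the induction step: a transition of the meander multiplies the sine transform by the
  Gaussian factor that is already part of \<open>damped_sine_transform\<close>.
\<close>
lemma killed_kernel_damped_sine:
  assumes tau: "\<tau> > 0" and F: "integrable lborel F" and supp: "\<And>y. y \<le> 0 \<Longrightarrow> F y = 0" and y: "y > 0"
  shows "integrable lborel (\<lambda>z. killed_kernel \<tau> y z * F z)"
    and "(\<integral>z. killed_kernel \<tau> y z * F z \<partial>lborel) =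
      2 / pi * (\<integral>u. sin (u * y) * damped_sine_transform \<tau> F u \<partial>lborel)"
proof -
  define H where "H = (\<lambda>u. sin (u * y) * (exp (- \<tau> * u\<^sup>2 / 2) * indicator {0<..} u))"
  have H: "integrable lborel H"
    unfolding H_def by (rule Bochner_Integration.integrable_bound[OF gaussian_half_line_integrable[OF tau]])
      (auto simp: abs_mult split: split_indicator)
  have eq: "killed_kernel \<tau> y z * F z = 2 / pi * (F z * (\<integral>u. sin (u * z) * H u \<partial>lborel))" for z
    using supp[of z] killed_kernel_sine[OF tau y, of z]
    by (cases "z > 0") (simp_all add: H_def mult.assoc mult.left_commute)
  show "integrable lborel (\<lambda>z. killed_kernel \<tau> y z * F z)"
    unfolding eq
    using bounded_kernel_Fubini(2)[OF H F sine_kernel_measurable] by (simp add: mult.commute)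
  have "(\<integral>z. killed_kernel \<tau> y z * F z \<partial>lborel) =
      2 / pi * (\<integral>u. H u * (\<integral>z. sin (u * z) * F z \<partial>lborel) \<partial>lborel)"
    unfolding eq integral_mult_right_zero
    using bounded_kernel_Fubini(1)[OF F H sine_kernel_measurable] by simp
  also have "(\<lambda>u. H u * (\<integral>z. sin (u * z) * F z \<partial>lborel)) = (\<lambda>u. sin (u * y) * damped_sine_transform \<tau> F u)"
    by (auto simp: H_def damped_sine_transform_def mult_ac)
  finally show "(\<integral>z. killed_kernel \<tau> y z * F z \<partial>lborel) =
      2 / pi * (\<integral>u. sin (u * y) * damped_sine_transform \<tau> F u \<partial>lborel)" .
qed

text \<open>
  The other half of the induction step: a transition of the process multiplies the inverse sine
  transform by the exponential weight of the meander.
\<close>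
lemma odd_cauchy_sine_integral:
  assumes s: "\<sigma> > 0" and A: "integrable lborel A" and supp: "\<And>u. u \<le> 0 \<Longrightarrow> A u = 0" and v: "v > 0"
  shows "integrable lborel (\<lambda>u. A u * odd_cauchy \<sigma> u v)"
    and "(\<integral>u. A u * odd_cauchy \<sigma> u v \<partial>lborel) =
      (\<integral>y. sin (v * y) * (2 / pi * (exp (- \<sigma> * y) * indicator {0<..} y * (\<integral>u. sin (u * y) * A u \<partial>lborel))) \<partial>lborel)"
proof -
  define F where "F = (\<lambda>y. sin (v * y) * (exp (- \<sigma> * y) * indicator {0<..} y))"
  have F: "integrable lborel F"
    unfolding F_def by (rule Bochner_Integration.integrable_bound[OF exponential_integrable[OF s]])
      (auto simp: abs_mult split: split_indicator)
  have eq: "A u * odd_cauchy \<sigma> u v = 2 / pi * (A u * (\<integral>y. sin (u * y) * F y \<partial>lborel))" for u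
    using supp[of u] odd_cauchy_sine[OF s _ v, of u]
    by (cases "u > 0") (simp_all add: F_def mult.assoc)
  show "integrable lborel (\<lambda>u. A u * odd_cauchy \<sigma> u v)"
    unfolding eq using bounded_kernel_Fubini(2)[OF F A sine_kernel_measurable] by simp
  have "(\<integral>u. A u * odd_cauchy \<sigma> u v \<partial>lborel) =
      (\<integral>y. 2 / pi * (F y * (\<integral>u. sin (u * y) * A u \<partial>lborel)) \<partial>lborel)"
    unfolding eq integral_mult_right_zero
    using bounded_kernel_Fubini(1)[OF F A sine_kernel_measurable] by simp
  then show "(\<integral>u. A u * odd_cauchy \<sigma> u v \<partial>lborel) =
      (\<integral>y. sin (v * y) * (2 / pi * (exp (- \<sigma> * y) * indicator {0<..} y * (\<integral>u. sin (u * y) * A u \<partial>lborel))) \<partial>lborel)"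
    by (simp add: F_def mult_ac)
qed

text \<open>
  The entrance law is itself a sine transform, so integrating against it amounts to integrating the
  damped sine transform against \<open>u\<close>. This is where the duality ends.
\<close>
lemma meander_entrance_damped_sine:
  assumes tau: "\<tau> > 0" and F: "integrable lborel F" and supp: "\<And>y. y \<le> 0 \<Longrightarrow> F y = 0"
  shows "integrable lborel (\<lambda>y. meander_entrance \<tau> y * F y)"
    and "integrable lborel (\<lambda>u. u * damped_sine_transform \<tau> F u)"
    and "(\<integral>y. meander_entrance \<tau> y * F y \<partial>lborel) =
      1 / pi * (\<integral>u. u * damped_sine_transform \<tau> F u \<partial>lborel)"
proof -
  define H where "H = (\<lambda>u. u * exp (- \<tau> * u\<^sup>2 / 2) * indicator {0<..} u)"
  have H: "integrable lborel H"
    unfolding H_def by (rule Bochner_Integration.integrable_bound[OF gaussian_moment_integrable[OF tau]])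
      (auto simp: abs_mult indicator_def intro!: AE_I2 mult_nonpos_nonneg)
  have eq: "meander_entrance \<tau> y * F y = 1 / pi * (F y * (\<integral>u. sin (u * y) * H u \<partial>lborel))" for y
    using supp[of y] meander_entrance_sine[OF tau, of y]
    by (cases "y > 0") (simp_all add: H_def)
  have eq2: "u * damped_sine_transform \<tau> F u = H u * (\<integral>z. sin (u * z) * F z \<partial>lborel)" for u
    by (simp add: damped_sine_transform_def H_def)
  show "integrable lborel (\<lambda>u. u * damped_sine_transform \<tau> F u)"
    unfolding eq2 using bounded_kernel_Fubini(2)[OF F H sine_kernel_measurable] by simp
  show "integrable lborel (\<lambda>y. meander_entrance \<tau> y * F y)"
    unfolding eq
    using bounded_kernel_Fubini(2)[OF H F sine_kernel_measurable] by (simp add: mult.commute)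
  show "(\<integral>y. meander_entrance \<tau> y * F y \<partial>lborel) =
      1 / pi * (\<integral>u. u * damped_sine_transform \<tau> F u \<partial>lborel)"
    unfolding eq eq2 integral_mult_right_zero
    using bounded_kernel_Fubini(1)[OF F H sine_kernel_measurable] by simp
qed

section \<open>Sine duality between the meander and the process\<close>

text \<open>
  The integrand that remains at one time of the meander after all later times have been integrated
  out. Index \<open>k\<close> belongs to the time \<open>1 - t (k + 1)\<close>, whose exponential weight is \<open>\<sigma> (k + 1)\<close>. The
  values are in \<open>ennreal\<close>, so that Tonelli's theorem applies before anything is known to be finite.
\<close>
primrec meander_weight :: "(nat \<Rightarrow> real) \<Rightarrow> (nat \<Rightarrow> real) \<Rightarrow> nat \<Rightarrow> real \<Rightarrow> ennreal" where
  "meander_weight \<sigma> \<tau> 0 y =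
     ennreal (exp (- \<sigma> 1 * y) * killed_survival (\<tau> 0) y * indicator {0<..} y)"
| "meander_weight \<sigma> \<tau> (Suc k) y =
     ennreal (exp (- \<sigma> (k + 2) * y)) *
       (\<integral>\<^sup>+z. ennreal (killed_kernel (\<tau> (k + 1)) y z) * meander_weight \<sigma> \<tau> k z \<partial>lborel)"

text \<open>
  The density of the state after \<open>k\<close> transitions from \<open>dx / sqrt x\<close>, with the exponential weights of
  the states up to that point included.
\<close>
primrec process_weight :: "(nat \<Rightarrow> real) \<Rightarrow> (nat \<Rightarrow> real) \<Rightarrow> nat \<Rightarrow> real \<Rightarrow> ennreal" where
  "process_weight \<sigma> \<tau> 0 x = ennreal (exp (- \<tau> 0 * x / 2) / sqrt x * indicator {0<..} x)"
| "process_weight \<sigma> \<tau> (Suc k) y =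
     ennreal (exp (- \<tau> (k + 1) * y / 2)) *
       (\<integral>\<^sup>+x. process_weight \<sigma> \<tau> k x * ennreal (trans_density (\<sigma> (k + 1)) x y) \<partial>lborel) * indicator {0<..} y"

lemma meander_weight_measurable [measurable]: "meander_weight \<sigma> \<tau> k \<in> borel_measurable borel"
proof (induction k)
  case (Suc k)
  note [measurable] = Suc
  show ?case unfolding meander_weight.simps[abs_def] by measurable
qed (simp add: meander_weight.simps[abs_def])

lemma process_weight_measurable [measurable]: "process_weight \<sigma> \<tau> k \<in> borel_measurable borel"
proof (induction k)
  case (Suc k)
  note [measurable] = Suc
  show ?case unfolding process_weight.simps[abs_def] by measurable
qed (simp add: process_weight.simps[abs_def])

lemma process_weight_support: "x \<le> 0 \<Longrightarrow> process_weight \<sigma> \<tau> k x = 0"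
  by (cases k) auto

text \<open>
  Written in the square roots of the states, the Jacobian \<open>2 u\<close> turns the transition density into
  \<open>odd_cauchy\<close>, the kernel that has a sine representation.
\<close>
lemma process_weight_Suc_square:
  assumes v: "v > 0" and s: "\<sigma> (k + 1) > 0"
  shows "process_weight \<sigma> \<tau> (Suc k) (v\<^sup>2) =
    ennreal (exp (- \<tau> (k + 1) * v\<^sup>2 / 2)) *
      (\<integral>\<^sup>+u. process_weight \<sigma> \<tau> k (u\<^sup>2) * ennreal (odd_cauchy (\<sigma> (k + 1)) u v) \<partial>lborel)"
proof -
  let ?p = "\<lambda>x. process_weight \<sigma> \<tau> k x * ennreal (trans_density (\<sigma> (k + 1)) x (v\<^sup>2))"
  have "(\<integral>\<^sup>+x. ?p x \<partial>lborel) = (\<integral>\<^sup>+x. ?p x * indicator {0<..} x \<partial>lborel)"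
    by (rule nn_integral_cong) (auto simp: process_weight_support split: split_indicator)
  also have "\<dots> = (\<integral>\<^sup>+u. ?p (u\<^sup>2) * ennreal (2 * u) * indicator {0<..} u \<partial>lborel)"
    by (rule nn_integral_square_substitution) measurable
  also have "\<dots> = (\<integral>\<^sup>+u. process_weight \<sigma> \<tau> k (u\<^sup>2) * ennreal (odd_cauchy (\<sigma> (k + 1)) u v) \<partial>lborel)"
  proof (rule nn_integral_cong)
    fix u :: real
    show "?p (u\<^sup>2) * ennreal (2 * u) * indicator {0<..} u =
      process_weight \<sigma> \<tau> k (u\<^sup>2) * ennreal (odd_cauchy (\<sigma> (k + 1)) u v)"
    proof (cases "u > 0")
      case True
      then show ?thesis using s v trans_density_nonneg[of "\<sigma> (k + 1)" "u\<^sup>2" "v\<^sup>2"]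
        by (simp add: mult.assoc ennreal_mult[symmetric] flip: trans_density_square)
    qed (simp add: odd_cauchy_def)
  qed
  finally show ?thesis using v by simp
qed

text \<open>
  By induction: a transition of the meander is the inverse sine transform of the damped sine transform,
  and a transition of the process applied to that damped transform is again a sine transform, namely of
  the new weight of the meander. The real function \<open>F\<close> is carried along because sine transforms need
  integrable real functions, whereas the weights have values in \<open>ennreal\<close>.
\<close>
lemma sine_duality:
  assumes s: "\<And>j. 1 \<le> j \<Longrightarrow> j \<le> k + 1 \<Longrightarrow> \<sigma> j > 0"
    and tau0: "\<tau> 0 \<ge> 0" and tau: "\<And>j. 1 \<le> j \<Longrightarrow> j \<le> k + 1 \<Longrightarrow> \<tau> j > 0"
  shows "\<exists>F. integrable lborel F \<and> (\<forall>y. F y \<ge> 0) \<and> (\<forall>y\<le>0. F y = 0) \<and>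
    (\<forall>y. meander_weight \<sigma> \<tau> k y = ennreal (F y)) \<and>
    (\<forall>v>0. damped_sine_transform (\<tau> (k + 1)) F v \<ge> 0 \<and>
       process_weight \<sigma> \<tau> (Suc k) (v\<^sup>2) = ennreal (damped_sine_transform (\<tau> (k + 1)) F v))"
  using s tau
proof (induction k)
  case 0
  have s1: "\<sigma> 1 > 0" using 0 by simp
  define F where "F = (\<lambda>y. exp (- \<sigma> 1 * y) * killed_survival (\<tau> 0) y * indicator {0<..} y)"
  define r where "r = (\<lambda>v. \<integral>y. sin (v * y) * F y \<partial>lborel)"
  have F_nonneg: "F y \<ge> 0" for y
    using tau0 by (simp add: F_def killed_survival_nonneg)
  have base: "integrable lborel F"
      "v > 0 \<Longrightarrow> r v \<ge> 0"
      "v > 0 \<Longrightarrow> (\<integral>\<^sup>+u. ennreal (exp (- \<tau> 0 * u\<^sup>2 / 2) / u * odd_cauchy (\<sigma> 1) u v) \<partial>lborel) = ennreal (r v)" for v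
    unfolding F_def r_def using survival_weight_integrable[OF s1 tau0] odd_cauchy_survival_integral[OF s1 _ tau0] by blast+
  have "process_weight \<sigma> \<tau> (Suc 0) (v\<^sup>2) = ennreal (damped_sine_transform (\<tau> 1) F v)" if v: "v > 0" for v
  proof -
    have "(\<integral>\<^sup>+u. process_weight \<sigma> \<tau> 0 (u\<^sup>2) * ennreal (odd_cauchy (\<sigma> 1) u v) \<partial>lborel) = ennreal (r v)"
      unfolding base(3)[OF v, symmetric]
    proof (rule nn_integral_cong)
      fix u :: real
      show "process_weight \<sigma> \<tau> 0 (u\<^sup>2) * ennreal (odd_cauchy (\<sigma> 1) u v) =
          ennreal (exp (- \<tau> 0 * u\<^sup>2 / 2) / u * odd_cauchy (\<sigma> 1) u v)"
        using s1 by (cases "u > 0") (auto simp: ennreal_mult[symmetric] odd_cauchy_nonneg odd_cauchy_def[of _ u])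
    qed
    then have "process_weight \<sigma> \<tau> (Suc 0) (v\<^sup>2) = ennreal (exp (- \<tau> 1 * v\<^sup>2 / 2)) * ennreal (r v)"
      using process_weight_Suc_square[OF v, of \<sigma> 0 \<tau>] s1 by (simp del: process_weight.simps)
    then show ?thesis
      using v base(2)[OF v] by (simp del: process_weight.simps add: damped_sine_transform_def r_def ennreal_mult)
  qed
  moreover have "damped_sine_transform (\<tau> 1) F v \<ge> 0" if "v > 0" for v
    using base(2)[OF that] that by (simp add: damped_sine_transform_def r_def)
  ultimately show ?case
    using F_nonneg base(1) by (intro exI[of _ F]) (simp del: process_weight.simps add: F_def)
next
  case (Suc k)
  then obtain F where F: "integrable lborel F" "\<And>y. F y \<ge> 0" "\<And>y. y \<le> 0 \<Longrightarrow> F y = 0"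
    and mF: "\<And>y. meander_weight \<sigma> \<tau> k y = ennreal (F y)"
    and A_nonneg: "\<And>v. v > 0 \<Longrightarrow> damped_sine_transform (\<tau> (k + 1)) F v \<ge> 0"
    and A: "\<And>v. v > 0 \<Longrightarrow> process_weight \<sigma> \<tau> (Suc k) (v\<^sup>2) = ennreal (damped_sine_transform (\<tau> (k + 1)) F v)"
    by (metis Suc_eq_plus1 le_Suc_eq)
  have t: "\<tau> (k + 1) > 0" and s: "\<sigma> (k + 2) > 0" using Suc.prems by auto
  let ?A = "damped_sine_transform (\<tau> (k + 1)) F"
  have A0: "?A u = 0" if "u \<le> 0" for u using that by (simp add: damped_sine_transform_def)
  have A_int: "integrable lborel ?A" by (rule damped_sine_transform_integrable[OF t F(1)])
  define F' where "F' = (\<lambda>y. exp (- \<sigma> (k + 2) * y) * (\<integral>z. killed_kernel (\<tau> (k + 1)) y z * F z \<partial>lborel))"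
  \<comment> \<open>The sine representation makes the integrability of the new weight visible; the defining integral shows its sign.\<close>
  have F'_eq: "F' = (\<lambda>y. 2 / pi * (exp (- \<sigma> (k + 2) * y) * indicator {0<..} y * (\<integral>u. sin (u * y) * ?A u \<partial>lborel)))"
  proof
    fix y
    show "F' y = 2 / pi * (exp (- \<sigma> (k + 2) * y) * indicator {0<..} y * (\<integral>u. sin (u * y) * ?A u \<partial>lborel))"
      using killed_kernel_damped_sine(2)[OF t F(1,3), of y]
      by (cases "y > 0") (simp_all add: F'_def killed_kernel_def)
  qed
  have F'_int: "integrable lborel F'"
    unfolding F'_eq
    using bounded_kernel_Fubini(2)[OF A_int exponential_integrable[OF s] sine_kernel_measurable]
    by (intro integrable_mult_right) (simp add: mult.commute)
  have F'_nonneg: "F' y \<ge> 0" for y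
    using t F(2) by (auto simp: F'_def intro!: mult_nonneg_nonneg killed_kernel_nonneg Bochner_Integration.integral_nonneg)
  have F'_supp: "F' y = 0" if "y \<le> 0" for y
    using that by (simp add: F'_eq)
  have "meander_weight \<sigma> \<tau> (Suc k) y = ennreal (F' y)" for y
  proof (cases "y > 0")
    case True
    have "(\<integral>\<^sup>+z. ennreal (killed_kernel (\<tau> (k + 1)) y z) * meander_weight \<sigma> \<tau> k z \<partial>lborel) =
        (\<integral>\<^sup>+z. ennreal (killed_kernel (\<tau> (k + 1)) y z * F z) \<partial>lborel)"
      using t by (simp add: mF ennreal_mult F(2) killed_kernel_nonneg)
    also have "\<dots> = ennreal (\<integral>z. killed_kernel (\<tau> (k + 1)) y z * F z \<partial>lborel)"
      using killed_kernel_damped_sine(1)[OF t F(1,3) True] F(2) t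
      by (intro nn_integral_eq_integral) (auto simp: killed_kernel_nonneg)
    finally show ?thesis by (simp add: F'_def ennreal_mult'[symmetric])
  next
    case False
    then show ?thesis by (simp add: F'_def killed_kernel_def)
  qed
  moreover have "damped_sine_transform (\<tau> (Suc k + 1)) F' v \<ge> 0 \<and>
      process_weight \<sigma> \<tau> (Suc (Suc k)) (v\<^sup>2) = ennreal (damped_sine_transform (\<tau> (Suc k + 1)) F' v)" if v: "v > 0" for v
  proof -
    have nonneg: "?A u * odd_cauchy (\<sigma> (k + 2)) u v \<ge> 0" for u
      using A_nonneg[of u] odd_cauchy_nonneg[of "\<sigma> (k + 2)" u v] s
      by (cases "u > 0") (auto simp: odd_cauchy_def)
    have sine: "(\<integral>u. ?A u * odd_cauchy (\<sigma> (k + 2)) u v \<partial>lborel) = (\<integral>y. sin (v * y) * F' y \<partial>lborel)"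
      using odd_cauchy_sine_integral(2)[OF s A_int A0 v] by (simp add: F'_eq)
    have "(\<integral>\<^sup>+u. process_weight \<sigma> \<tau> (Suc k) (u\<^sup>2) * ennreal (odd_cauchy (\<sigma> (k + 2)) u v) \<partial>lborel) =
        (\<integral>\<^sup>+u. ennreal (?A u * odd_cauchy (\<sigma> (k + 2)) u v) \<partial>lborel)"
    proof (rule nn_integral_cong)
      fix u :: real
      show "process_weight \<sigma> \<tau> (Suc k) (u\<^sup>2) * ennreal (odd_cauchy (\<sigma> (k + 2)) u v) =
          ennreal (?A u * odd_cauchy (\<sigma> (k + 2)) u v)"
      proof (cases "u > 0")
        case True
        then show ?thesis
          using s by (simp only: A ennreal_mult[OF A_nonneg odd_cauchy_nonneg] less_imp_le)
      qed (simp add: odd_cauchy_def)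
    qed
    also have "\<dots> = ennreal (\<integral>y. sin (v * y) * F' y \<partial>lborel)"
      unfolding sine[symmetric]
      using odd_cauchy_sine_integral(1)[OF s A_int A0 v] nonneg by (intro nn_integral_eq_integral) auto
    finally have "process_weight \<sigma> \<tau> (Suc (Suc k)) (v\<^sup>2) =
        ennreal (exp (- \<tau> (Suc k + 1) * v\<^sup>2 / 2)) * ennreal (\<integral>y. sin (v * y) * F' y \<partial>lborel)"
      using s process_weight_Suc_square[OF v, of \<sigma> "Suc k" \<tau>] by (simp del: process_weight.simps)
    moreover have "(\<integral>y. sin (v * y) * F' y \<partial>lborel) \<ge> 0"
      unfolding sine[symmetric] by (intro Bochner_Integration.integral_nonneg nonneg)
    ultimately show ?thesis
      using v by (simp del: process_weight.simps add: damped_sine_transform_def ennreal_mult)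
  qed
  ultimately show ?case
    using F'_int F'_nonneg F'_supp by (intro exI[of _ F']) (simp del: process_weight.simps meander_weight.simps)
qed

section \<open>Laplace functionals of the process\<close>

context markov_process_from
begin

lemma X_measurable: "t \<ge> 0 \<Longrightarrow> X t \<in> borel_measurable N"
  using random_variable_X[of t] by (simp add: measurable_restrict_space2_iff)

lemma X_nonneg: "t \<ge> 0 \<Longrightarrow> \<omega> \<in> space N \<Longrightarrow> X t \<omega> \<ge> 0"
  using random_variable_X[of t] by (auto simp: measurable_restrict_space2_iff)

lemma space_natural_filtration: "space (natural_filtration N X s) = space N"
  unfolding natural_filtration_def by (rule space_measure_of) auto

lemma sets_natural_filtration:
  "sets (natural_filtration N X s) =
    sigma_sets (space N) {X u -` A \<inter> space N | u A. u \<in> {0..s} \<and> A \<in> sets borel}"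
  unfolding natural_filtration_def by (rule sets_measure_of) auto

lemma subalgebra_natural_filtration: "subalgebra N (natural_filtration N X s)"
  unfolding subalgebra_def
proof
  show "sets (natural_filtration N X s) \<subseteq> sets N"
    unfolding sets_natural_filtration
    using X_measurable by (intro sets.sigma_sets_subset) (auto dest: measurable_sets)
qed (rule space_natural_filtration)

lemma X_adapted: "0 \<le> u \<Longrightarrow> u \<le> s \<Longrightarrow> X u \<in> borel_measurable (natural_filtration N X s)"
  by (rule measurableI) (auto simp: space_natural_filtration sets_natural_filtration)

text \<open>
  The Markov property for the set of all reals says that the integral of the density is \<open>1\<close>. A
  function that is not integrable would have the integral \<open>0\<close>.
\<close>
lemma trans_density_AE_integrable:
  assumes st: "0 \<le> s" "s < t"
  shows "AE \<omega> in N. integrable lborel (\<lambda>y. trans_density (t - s) (X s \<omega>) y * indicator {0..} y)"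
proof -
  interpret finite_measure_subalgebra N "natural_filtration N X s"
    by unfold_locales (rule subalgebra_natural_filtration)
  have "AE \<omega> in N. real_cond_exp N (natural_filtration N X s) (\<lambda>\<omega>. 1) \<omega> = 1"
    by (rule real_cond_exp_F_meas) auto
  moreover have "AE \<omega> in N. real_cond_exp N (natural_filtration N X s) (\<lambda>\<omega>. 1) \<omega> =
      (LINT y:{0..}|lborel. trans_density (t - s) (X s \<omega>) y)"
    using markov[OF st, of UNIV] by simp
  ultimately show ?thesis
  proof eventually_elim
    case (elim \<omega>)
    then have "(\<integral>y. trans_density (t - s) (X s \<omega>) y * indicator {0..} y \<partial>lborel) = 1"
      by (simp add: set_lebesgue_integral_def mult.commute)
    then show ?case by (metis not_integrable_integral_eq zero_neq_one)
  qed
qed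

text \<open>
  The Markov property is given for indicators of Borel sets only. As functions of \<open>f\<close>, however, both
  sides are integrals against measures, and these measures agree on Borel sets.
\<close>
lemma markov_step:
  assumes st: "0 \<le> s" "s < t"
    and Z: "Z \<in> borel_measurable (natural_filtration N X s)" "\<And>\<omega>. 0 \<le> Z \<omega>"
    and bound: "\<And>\<omega>. \<omega> \<in> space N \<Longrightarrow> Z \<omega> \<le> C"
    and f[measurable]: "f \<in> borel_measurable borel"
  shows "(\<integral>\<^sup>+\<omega>. ennreal (Z \<omega>) * f (X t \<omega>) \<partial>N) =
    (\<integral>\<^sup>+\<omega>. ennreal (Z \<omega>) *
       (\<integral>\<^sup>+y. f y * ennreal (trans_density (t - s) (X s \<omega>) y * indicator {0..} y) \<partial>lborel) \<partial>N)"
proof -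
  interpret finite_measure_subalgebra N "natural_filtration N X s"
    by unfold_locales (rule subalgebra_natural_filtration)
  interpret NL: pair_sigma_finite N lborel ..
  let ?p = "\<lambda>\<omega> y. trans_density (t - s) (X s \<omega>) y * indicator {0..} y"
  have [measurable]: "X s \<in> borel_measurable N" "X t \<in> borel_measurable N"
    using st X_measurable by auto
  have [measurable]: "Z \<in> borel_measurable N"
    using measurable_from_subalg[OF subalgebra_natural_filtration Z(1)] .
  define D where "D = (\<lambda>y. \<integral>\<^sup>+\<omega>. ennreal (Z \<omega>) * ennreal (?p \<omega> y) \<partial>N)"
  have [measurable]: "D \<in> borel_measurable lborel" unfolding D_def by measurable
  have Tonelli: "(\<integral>\<^sup>+y. D y * h y \<partial>lborel) =
      (\<integral>\<^sup>+\<omega>. ennreal (Z \<omega>) * (\<integral>\<^sup>+y. h y * ennreal (?p \<omega> y) \<partial>lborel) \<partial>N)"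
    if [measurable]: "h \<in> borel_measurable borel" for h
  proof -
    have "(\<integral>\<^sup>+y. D y * h y \<partial>lborel) =
        (\<integral>\<^sup>+y. (\<integral>\<^sup>+\<omega>. ennreal (Z \<omega>) * (h y * ennreal (?p \<omega> y)) \<partial>N) \<partial>lborel)"
      unfolding D_def by (subst nn_integral_multc[symmetric]) (simp_all add: mult_ac)
    also have "\<dots> = (\<integral>\<^sup>+\<omega>. (\<integral>\<^sup>+y. ennreal (Z \<omega>) * (h y * ennreal (?p \<omega> y)) \<partial>lborel) \<partial>N)"
      by (rule NL.Fubini') measurable
    finally show ?thesis by (simp add: nn_integral_cmult)
  qed
  have "distr (density N (\<lambda>\<omega>. ennreal (Z \<omega>))) lborel (X t) = density lborel D"
  proof (rule measure_eqI)
    fix A assume "A \<in> sets (distr (density N (\<lambda>\<omega>. ennreal (Z \<omega>))) lborel (X t))"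
    then have A[measurable]: "A \<in> sets borel" by simp
    let ?K = "\<lambda>\<omega>. LINT y:A \<inter> {0..}|lborel. trans_density (t - s) (X s \<omega>) y"
    let ?E = "real_cond_exp N (natural_filtration N X s) (\<lambda>\<omega>. indicator A (X t \<omega>))"
    have K_meas [measurable]: "?K \<in> borel_measurable N"
      unfolding set_lebesgue_integral_def by measurable
    have K_nonneg: "AE \<omega> in N. ?K \<omega> \<ge> 0"
      using st X_nonneg[of s]
      by (intro AE_I2) (auto simp: set_lebesgue_integral_def trans_density_nonneg indicator_def
          intro!: Bochner_Integration.integral_nonneg)
    have K: "AE \<omega> in N. ?E \<omega> = ?K \<omega>" by (rule markov[OF st A])
    have Z_int: "integrable N (\<lambda>\<omega>. Z \<omega> * indicator A (X t \<omega>))"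
    proof (rule integrable_const_bound[of _ C])
      show "AE \<omega> in N. norm (Z \<omega> * indicator A (X t \<omega>)) \<le> C"
        using bound Z(2) by (intro AE_I2) (auto simp: indicator_def intro: order_trans)
    qed measurable
    note E = real_cond_exp_intg[OF Z_int Z(1)]
    have ZK_int: "integrable N (\<lambda>\<omega>. Z \<omega> * ?K \<omega>)"
      using E(1) K by (subst integrable_cong_AE[where g = "\<lambda>\<omega>. Z \<omega> * ?E \<omega>"]) auto
    have "emeasure (distr (density N (\<lambda>\<omega>. ennreal (Z \<omega>))) lborel (X t)) A =
        (\<integral>\<^sup>+\<omega>. ennreal (Z \<omega> * indicator A (X t \<omega>)) \<partial>N)"
      using Z(2) by (simp add: emeasure_distr emeasure_density)
        (auto intro!: nn_integral_cong split: split_indicator)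
    also have "\<dots> = ennreal (\<integral>\<omega>. Z \<omega> * indicator A (X t \<omega>) \<partial>N)"
      using Z_int Z(2) by (intro nn_integral_eq_integral) auto
    also have "(\<integral>\<omega>. Z \<omega> * indicator A (X t \<omega>) \<partial>N) = (\<integral>\<omega>. Z \<omega> * ?K \<omega> \<partial>N)"
      using E(2) K by (subst integral_cong_AE[where g = "\<lambda>\<omega>. Z \<omega> * ?E \<omega>"]) auto
    also have "ennreal \<dots> = (\<integral>\<^sup>+\<omega>. ennreal (Z \<omega> * ?K \<omega>) \<partial>N)"
      using ZK_int K_nonneg Z(2) by (intro nn_integral_eq_integral[symmetric]) auto
    also have "\<dots> = (\<integral>\<^sup>+\<omega>. ennreal (Z \<omega>) * (\<integral>\<^sup>+y. indicator A y * ennreal (?p \<omega> y) \<partial>lborel) \<partial>N)"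
    proof (rule nn_integral_cong_AE)
      show "AE \<omega> in N. ennreal (Z \<omega> * ?K \<omega>) =
          ennreal (Z \<omega>) * (\<integral>\<^sup>+y. indicator A y * ennreal (?p \<omega> y) \<partial>lborel)"
        using trans_density_AE_integrable[OF st] AE_space
      proof eventually_elim
        case (elim \<omega>)
        have p_nonneg: "?p \<omega> y \<ge> 0" for y
          using st elim(2) X_nonneg by (auto simp: indicator_def trans_density_nonneg)
        have "(\<integral>\<^sup>+y. indicator A y * ennreal (?p \<omega> y) \<partial>lborel) = (\<integral>\<^sup>+y. ennreal (?p \<omega> y * indicator A y) \<partial>lborel)"
          by (intro nn_integral_cong) (auto split: split_indicator)
        also have "\<dots> = ennreal (\<integral>y. ?p \<omega> y * indicator A y \<partial>lborel)"
        proof (rule nn_integral_eq_integral)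
          show "integrable lborel (\<lambda>y. ?p \<omega> y * indicator A y)"
            by (rule integrable_real_mult_indicator[OF _ elim(1)]) simp
        qed (use p_nonneg in \<open>auto intro: AE_I2 mult_nonneg_nonneg\<close>)
        also have "(\<integral>y. ?p \<omega> y * indicator A y \<partial>lborel) = ?K \<omega>"
          unfolding set_lebesgue_integral_def
          by (intro Bochner_Integration.integral_cong) (auto split: split_indicator)
        finally show ?case using Z(2) by (simp add: ennreal_mult')
      qed
    qed
    also have "\<dots> = (\<integral>\<^sup>+y. D y * indicator A y \<partial>lborel)"
      by (rule Tonelli[symmetric]) measurable
    finally show "emeasure (distr (density N (\<lambda>\<omega>. ennreal (Z \<omega>))) lborel (X t)) A =
        emeasure (density lborel D) A"
      by (simp add: emeasure_density)
  qed simp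
  then have "(\<integral>\<^sup>+y. f y \<partial>distr (density N (\<lambda>\<omega>. ennreal (Z \<omega>))) lborel (X t)) = (\<integral>\<^sup>+y. f y \<partial>density lborel D)"
    by simp
  then show ?thesis
    by (simp add: nn_integral_distr nn_integral_density Tonelli)
qed

end

definition laplace_functional ::
  "'a measure \<Rightarrow> (real \<Rightarrow> 'a \<Rightarrow> real) \<Rightarrow> (nat \<Rightarrow> real) \<Rightarrow> (nat \<Rightarrow> real) \<Rightarrow> nat \<Rightarrow> (real \<Rightarrow> ennreal) \<Rightarrow> ennreal" where
  "laplace_functional N X s \<tau> k f =
     (\<integral>\<^sup>+\<omega>. ennreal (exp (- (1 / 2) * (\<Sum>j=0..k. \<tau> j * X (s j) \<omega>))) * f (X (s k) \<omega>) \<partial>N)"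

definition damped_transition :: "real \<Rightarrow> real \<Rightarrow> (real \<Rightarrow> ennreal) \<Rightarrow> real \<Rightarrow> ennreal" where
  "damped_transition \<sigma> \<tau> f x =
     (\<integral>\<^sup>+y. ennreal (exp (- \<tau> * y / 2)) * f y * ennreal (trans_density \<sigma> x y * indicator {0..} y) \<partial>lborel)"

lemma damped_transition_measurable [measurable]:
  assumes [measurable]: "f \<in> borel_measurable borel"
  shows "damped_transition \<sigma> \<tau> f \<in> borel_measurable borel"
  unfolding damped_transition_def[abs_def] by measurable

lemma (in markov_process_from) laplace_functional_0:
  assumes "s 0 = 0" and [measurable]: "f \<in> borel_measurable borel"
  shows "laplace_functional N X s \<tau> 0 f = ennreal (exp (- \<tau> 0 * x / 2)) * f x"
proof -
  have "laplace_functional N X s \<tau> 0 f = (\<integral>\<^sup>+\<omega>. ennreal (exp (- \<tau> 0 * x / 2)) * f x \<partial>N)"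
    unfolding laplace_functional_def
    by (rule nn_integral_cong_AE) (use start in \<open>eventually_elim, simp add: assms(1)\<close>)
  then show ?thesis by (simp add: emeasure_space_1)
qed

lemma (in markov_process_from) laplace_functional_Suc:
  assumes s: "\<And>j. j \<le> k \<Longrightarrow> 0 \<le> s j \<and> s j \<le> s k" "s k < s (Suc k)"
    and tau: "\<And>j. j \<le> k \<Longrightarrow> \<tau> j \<ge> 0"
    and [measurable]: "f \<in> borel_measurable borel"
  shows "laplace_functional N X s \<tau> (Suc k) f =
    laplace_functional N X s \<tau> k (damped_transition (s (Suc k) - s k) (\<tau> (Suc k)) f)"
proof -
  let ?Z = "\<lambda>\<omega>. exp (- (1 / 2) * (\<Sum>j=0..k. \<tau> j * X (s j) \<omega>))"
  have "laplace_functional N X s \<tau> (Suc k) f =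
    (\<integral>\<^sup>+\<omega>. ennreal (?Z \<omega>) * (ennreal (exp (- \<tau> (Suc k) * X (s (Suc k)) \<omega> / 2)) * f (X (s (Suc k)) \<omega>)) \<partial>N)"
    unfolding laplace_functional_def
  proof (rule nn_integral_cong)
    fix \<omega>
    have "exp (- (1 / 2) * (\<Sum>j=0..Suc k. \<tau> j * X (s j) \<omega>)) =
        ?Z \<omega> * exp (- \<tau> (Suc k) * X (s (Suc k)) \<omega> / 2)"
      by (simp add: exp_add[symmetric] algebra_simps)
    then show "ennreal (exp (- (1 / 2) * (\<Sum>j=0..Suc k. \<tau> j * X (s j) \<omega>))) * f (X (s (Suc k)) \<omega>) =
        ennreal (?Z \<omega>) * (ennreal (exp (- \<tau> (Suc k) * X (s (Suc k)) \<omega> / 2)) * f (X (s (Suc k)) \<omega>))"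
      by (simp only: ennreal_mult exp_ge_zero mult.assoc)
  qed
  also have "\<dots> = laplace_functional N X s \<tau> k (damped_transition (s (Suc k) - s k) (\<tau> (Suc k)) f)"
    unfolding laplace_functional_def damped_transition_def
  proof (rule markov_step[where C = 1])
    have "X (s j) \<in> borel_measurable (natural_filtration N X (s k))" if "j \<le> k" for j
      using s(1)[OF that] by (intro X_adapted) auto
    then show "?Z \<in> borel_measurable (natural_filtration N X (s k))"
      by measurable
    show "?Z \<omega> \<le> 1" if "\<omega> \<in> space N" for \<omega>
      using that s(1) tau X_nonneg by (auto intro!: sum_nonneg mult_nonneg_nonneg)
  qed (use s in auto)
  finally show ?thesis .
qed

text \<open>
  Each transition is moved from the expectation to the test function \<open>f\<close>, and then by Tonelli's
  theorem to the weight. The function \<open>\<psi>\<close> is needed because the family \<open>P\<close> is given separately for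
  every \<open>x\<close>: that the expectation is measurable in its starting point is a consequence of the
  representation by kernels.
\<close>
lemma process_weight_functional:
  fixes P :: "real \<Rightarrow> 'b measure"
  assumes process: "\<And>x. x > 0 \<Longrightarrow> markov_process_from (P x) X x"
    and s0: "s 0 = 0" and s: "\<And>j. j < k \<Longrightarrow> s j < s (Suc j)"
    and tau: "\<And>j. j \<le> k \<Longrightarrow> \<tau> j \<ge> 0"
    and f: "f \<in> borel_measurable borel"
  shows "\<exists>\<psi> \<in> borel_measurable borel.
    (\<forall>x>0. laplace_functional (P x) X s \<tau> k f = \<psi> x) \<and>
    (\<integral>\<^sup>+x. ennreal (1 / sqrt x * indicator {0<..} x) * \<psi> x \<partial>lborel) =
      (\<integral>\<^sup>+y. process_weight (\<lambda>j. s j - s (j - 1)) \<tau> k y * f y \<partial>lborel)"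
  using s tau f
proof (induction k arbitrary: f)
  case 0
  note [measurable] = 0(3)
  let ?\<psi> = "\<lambda>x. ennreal (exp (- \<tau> 0 * x / 2)) * f x"
  have "\<forall>x>0. laplace_functional (P x) X s \<tau> 0 f = ?\<psi> x"
    using markov_process_from.laplace_functional_0[where s = s, OF process s0] by simp
  moreover have "(\<integral>\<^sup>+x. ennreal (1 / sqrt x * indicator {0<..} x) * ?\<psi> x \<partial>lborel) =
      (\<integral>\<^sup>+y. process_weight (\<lambda>j. s j - s (j - 1)) \<tau> 0 y * f y \<partial>lborel)"
    by (intro nn_integral_cong)
       (auto simp: mult.assoc[symmetric] ennreal_mult[symmetric] split: split_indicator)
  ultimately show ?case by (intro bexI[of _ ?\<psi>]) auto
next
  case (Suc k)
  note [measurable] = Suc.prems(3)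
  have mono: "s i \<le> s j" if "i \<le> j" "j \<le> Suc k" for i j
    using that
  proof (induction j rule: dec_induct)
    case (step n)
    then show ?case using Suc.prems(1)[of n] by simp
  qed simp
  let ?\<sigma> = "s (Suc k) - s k"
  let ?g = "damped_transition ?\<sigma> (\<tau> (Suc k)) f"
  have \<sigma>: "?\<sigma> > 0" using Suc.prems(1)[of k] by simp
  have "\<exists>\<psi> \<in> borel_measurable borel.
    (\<forall>x>0. laplace_functional (P x) X s \<tau> k ?g = \<psi> x) \<and>
    (\<integral>\<^sup>+x. ennreal (1 / sqrt x * indicator {0<..} x) * \<psi> x \<partial>lborel) =
      (\<integral>\<^sup>+y. process_weight (\<lambda>j. s j - s (j - 1)) \<tau> k y * ?g y \<partial>lborel)"
    by (rule Suc.IH) (auto intro!: Suc.prems)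
  then obtain \<psi> where \<psi>: "\<psi> \<in> borel_measurable borel"
    "\<And>x. x > 0 \<Longrightarrow> laplace_functional (P x) X s \<tau> k ?g = \<psi> x"
    "(\<integral>\<^sup>+x. ennreal (1 / sqrt x * indicator {0<..} x) * \<psi> x \<partial>lborel) =
      (\<integral>\<^sup>+y. process_weight (\<lambda>j. s j - s (j - 1)) \<tau> k y * ?g y \<partial>lborel)"
    by blast
  have "laplace_functional (P x) X s \<tau> (Suc k) f = \<psi> x" if "x > 0" for x
    unfolding \<psi>(2)[OF that, symmetric]
    using mono[of 0] mono[of _ k] Suc.prems s0
    by (intro markov_process_from.laplace_functional_Suc[OF process[OF that]]) auto
  moreover have "(\<integral>\<^sup>+x. process_weight (\<lambda>j. s j - s (j - 1)) \<tau> k x * ?g x \<partial>lborel) =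
      (\<integral>\<^sup>+y. process_weight (\<lambda>j. s j - s (j - 1)) \<tau> (Suc k) y * f y \<partial>lborel)"
  proof -
    let ?w = "process_weight (\<lambda>j. s j - s (j - 1)) \<tau> k"
    let ?e = "\<lambda>y. ennreal (exp (- \<tau> (Suc k) * y / 2))"
    have "(\<integral>\<^sup>+x. ?w x * ?g x \<partial>lborel) =
      (\<integral>\<^sup>+x. (\<integral>\<^sup>+y. ?w x * (?e y * f y * ennreal (trans_density ?\<sigma> x y * indicator {0..} y)) \<partial>lborel) \<partial>lborel)"
      unfolding damped_transition_def by (simp add: nn_integral_cmult)
    also have "\<dots> = (\<integral>\<^sup>+y. (\<integral>\<^sup>+x. ?w x * (?e y * f y * ennreal (trans_density ?\<sigma> x y * indicator {0..} y)) \<partial>lborel) \<partial>lborel)"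
      by (rule lborel_pair.Fubini') measurable
    also have "\<dots> = (\<integral>\<^sup>+y. process_weight (\<lambda>j. s j - s (j - 1)) \<tau> (Suc k) y * f y \<partial>lborel)"
    proof (rule nn_integral_cong)
      fix y :: real
      consider "y > 0" | "y = 0" | "y < 0" by linarith
      then show "(\<integral>\<^sup>+x. ?w x * (?e y * f y * ennreal (trans_density ?\<sigma> x y * indicator {0..} y)) \<partial>lborel) =
          process_weight (\<lambda>j. s j - s (j - 1)) \<tau> (Suc k) y * f y"
      proof cases
        case 1
        have "(\<integral>\<^sup>+x. ?w x * (?e y * f y * ennreal (trans_density ?\<sigma> x y * indicator {0..} y)) \<partial>lborel) =
          (\<integral>\<^sup>+x. (?e y * f y) * (?w x * ennreal (trans_density ?\<sigma> x y)) \<partial>lborel)"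
          using 1 by (simp add: mult_ac)
        also have "\<dots> = (?e y * f y) * (\<integral>\<^sup>+x. ?w x * ennreal (trans_density ?\<sigma> x y) \<partial>lborel)"
          by (rule nn_integral_cmult) measurable
        finally show ?thesis using 1 by (simp add: mult_ac)
      qed (simp_all add: trans_density_def)
    qed
    finally show ?thesis .
  qed
  ultimately show ?case using \<psi>(1,3) by (intro bexI[of _ \<psi>]) auto
qed

text \<open>
  If the total is infinite, then both sides have the default value \<open>0\<close>, on the left as the integral of
  a function that is not integrable.
\<close>
lemma process_weight_laplace:
  fixes P :: "real \<Rightarrow> 'b measure"
  assumes process: "\<And>x. x > 0 \<Longrightarrow> markov_process_from (P x) X x"
    and s0: "s 0 = 0" and s: "\<And>j. j < k \<Longrightarrow> s j < s (j + 1)"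
    and tau: "\<And>j. j \<le> k \<Longrightarrow> \<tau> j \<ge> 0"
  shows "(LINT x:{0<..}|lborel. (\<integral>\<omega>. exp (- (1 / 2) * (\<Sum>j=0..k. \<tau> j * X (s j) \<omega>)) \<partial>P x) * (1 / sqrt x)) =
    enn2real (\<integral>\<^sup>+y. process_weight (\<lambda>j. s j - s (j - 1)) \<tau> k y \<partial>lborel)"
proof -
  obtain \<psi> where [measurable]: "\<psi> \<in> borel_measurable borel"
    and \<psi>: "\<And>x. x > 0 \<Longrightarrow> laplace_functional (P x) X s \<tau> k (\<lambda>_. 1) = \<psi> x"
    and total: "(\<integral>\<^sup>+x. ennreal (1 / sqrt x * indicator {0<..} x) * \<psi> x \<partial>lborel) =
      (\<integral>\<^sup>+y. process_weight (\<lambda>j. s j - s (j - 1)) \<tau> k y * 1 \<partial>lborel)"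
    using process_weight_functional[where P = P and X = X and s = s and k = k and \<tau> = \<tau> and f = "\<lambda>_. 1"] process s0 s tau by auto
  have s_nonneg: "s j \<ge> 0" if "j \<le> k" for j
    using that by (induction j) (use s0 s in \<open>auto simp: less_imp_le order_trans Suc_le_eq\<close>)
  let ?E = "\<lambda>x. \<integral>\<omega>. exp (- (1 / 2) * (\<Sum>j=0..k. \<tau> j * X (s j) \<omega>)) \<partial>P x"
  have E: "ennreal (?E x) = \<psi> x" if x: "x > 0" for x
  proof -
    interpret markov_process_from "P x" X x by (rule process[OF x])
    have [measurable]: "X (s j) \<in> borel_measurable (P x)" if "j \<in> {0..k}" for j
      using s_nonneg that by (intro X_measurable) auto
    have "integrable (P x) (\<lambda>\<omega>. exp (- (1 / 2) * (\<Sum>j=0..k. \<tau> j * X (s j) \<omega>)))"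
    proof (rule integrable_const_bound[of _ 1])
      show "AE \<omega> in P x. norm (exp (- (1 / 2) * (\<Sum>j=0..k. \<tau> j * X (s j) \<omega>))) \<le> 1"
        using tau s_nonneg X_nonneg by (intro AE_I2) (auto intro!: sum_nonneg mult_nonneg_nonneg)
    qed measurable
    then have "ennreal (?E x) = laplace_functional (P x) X s \<tau> k (\<lambda>_. 1)"
      unfolding laplace_functional_def by (subst nn_integral_eq_integral[symmetric]) auto
    then show ?thesis using \<psi>[OF x] by simp
  qed
  have E_real: "?E x = enn2real (\<psi> x)" if "x > 0" for x
    unfolding E[OF that, symmetric] by (simp add: Bochner_Integration.integral_nonneg)
  have "(LINT x:{0<..}|lborel. ?E x * (1 / sqrt x)) =
      (\<integral>x. 1 / sqrt x * indicator {0<..} x * enn2real (\<psi> x) \<partial>lborel)"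
    unfolding set_lebesgue_integral_def
    by (intro Bochner_Integration.integral_cong) (auto simp: E_real[simplified] split: split_indicator)
  also have "\<dots> = enn2real (\<integral>\<^sup>+x. ennreal (1 / sqrt x * indicator {0<..} x * enn2real (\<psi> x)) \<partial>lborel)"
    by (rule integral_eq_nn_integral) (auto split: split_indicator)
  also have "(\<integral>\<^sup>+x. ennreal (1 / sqrt x * indicator {0<..} x * enn2real (\<psi> x)) \<partial>lborel) =
      (\<integral>\<^sup>+x. ennreal (1 / sqrt x * indicator {0<..} x) * \<psi> x \<partial>lborel)"
  proof (rule nn_integral_cong)
    fix x :: real
    show "ennreal (1 / sqrt x * indicator {0<..} x * enn2real (\<psi> x)) = ennreal (1 / sqrt x * indicator {0<..} x) * \<psi> x"
    proof (cases "x > 0")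
      case True
      then have "ennreal (enn2real (\<psi> x)) = \<psi> x" using E[OF True] by (metis E_real)
      then show ?thesis by (subst ennreal_mult) (use True in simp_all)
    qed simp
  qed
  finally show ?thesis using total by simp
qed

section \<open>Laplace transform of the meander\<close>

text \<open>
  Only the last two factors depend on the last coordinate, and integrating it out gives a chain of the
  same form with a new final factor.
\<close>
lemma nn_integral_chain_peel:
  fixes l \<phi> :: "real \<Rightarrow> ennreal" and K :: "nat \<Rightarrow> real \<Rightarrow> real \<Rightarrow> ennreal"
  assumes n: "n \<ge> 1"
    and [measurable]: "l \<in> borel_measurable borel" "\<phi> \<in> borel_measurable borel"
    and K: "\<And>j. case_prod (K j) \<in> borel_measurable (borel \<Otimes>\<^sub>M borel)"
  shows "(\<integral>\<^sup>+y. l (y 1) * (\<Prod>j=1..<Suc n. K j (y j) (y (Suc j))) * \<phi> (y (Suc n)) \<partial>(\<Pi>\<^sub>M j\<in>{1..Suc n}. lborel)) =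
    (\<integral>\<^sup>+y. l (y 1) * (\<Prod>j=1..<n. K j (y j) (y (Suc j))) * (\<integral>\<^sup>+z. K n (y n) z * \<phi> z \<partial>lborel) \<partial>(\<Pi>\<^sub>M j\<in>{1..n}. lborel))"
proof -
  interpret product_sigma_finite "\<lambda>_::nat. lborel :: real measure" ..
  have K_meas: "(\<lambda>x. K j (f x) (g x)) \<in> borel_measurable M"
    if "f \<in> borel_measurable M" "g \<in> borel_measurable M" for j f g and M :: "(nat \<Rightarrow> real) measure"
    using measurable_compose[OF measurable_Pair[OF that] K[of j]] by simp
  have comp: "(\<lambda>y :: nat \<Rightarrow> real. y j) \<in> borel_measurable (\<Pi>\<^sub>M j\<in>I. lborel)" if "j \<in> I" for j :: nat and I
    using measurable_component_singleton[OF that, of "\<lambda>_. lborel :: real measure"] by simp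
  have "(\<lambda>y. l (y 1) * (\<Prod>j=1..<Suc n. K j (y j) (y (Suc j))) * \<phi> (y (Suc n))) \<in>
      borel_measurable (\<Pi>\<^sub>M j\<in>{1..Suc n}. lborel)"
  proof (intro borel_measurable_times_ennreal borel_measurable_prod_ennreal K_meas comp)
    show "(\<lambda>y. l (y 1)) \<in> borel_measurable (\<Pi>\<^sub>M j\<in>{1..Suc n}. lborel)"
      by (rule measurable_compose[OF comp]) auto
    show "(\<lambda>y. \<phi> (y (Suc n))) \<in> borel_measurable (\<Pi>\<^sub>M j\<in>{1..Suc n}. lborel)"
      by (rule measurable_compose[OF comp]) auto
  qed auto
  moreover have "{1..Suc n} = insert (Suc n) {1..n}" by auto
  ultimately have "(\<integral>\<^sup>+y. l (y 1) * (\<Prod>j=1..<Suc n. K j (y j) (y (Suc j))) * \<phi> (y (Suc n)) \<partial>(\<Pi>\<^sub>M j\<in>{1..Suc n}. lborel)) =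
    (\<integral>\<^sup>+y. (\<integral>\<^sup>+z. l ((y(Suc n := z)) 1) * (\<Prod>j=1..<Suc n. K j ((y(Suc n := z)) j) ((y(Suc n := z)) (Suc j))) *
       \<phi> ((y(Suc n := z)) (Suc n)) \<partial>lborel) \<partial>(\<Pi>\<^sub>M j\<in>{1..n}. lborel))"
    by (simp only:) (rule product_nn_integral_insert, auto)
  also have "\<dots> = (\<integral>\<^sup>+y. l (y 1) * (\<Prod>j=1..<n. K j (y j) (y (Suc j))) * (\<integral>\<^sup>+z. K n (y n) z * \<phi> z \<partial>lborel) \<partial>(\<Pi>\<^sub>M j\<in>{1..n}. lborel))"
  proof (rule nn_integral_cong)
    fix y :: "nat \<Rightarrow> real"
    have prod: "(\<Prod>j=1..<Suc n. K j ((y(Suc n := z)) j) ((y(Suc n := z)) (Suc j))) =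
        (\<Prod>j=1..<n. K j (y j) (y (Suc j))) * K n (y n) z" for z
      using n by (simp add: prod.atLeastLessThan_Suc)
    have [measurable]: "(\<lambda>z. K n (y n) z) \<in> borel_measurable borel"
      using measurable_compose[OF measurable_Pair[OF measurable_const[of "y n"] measurable_ident] K[of n]] by simp
    have "(\<integral>\<^sup>+z. l ((y(Suc n := z)) 1) * (\<Prod>j=1..<Suc n. K j ((y(Suc n := z)) j) ((y(Suc n := z)) (Suc j))) *
        \<phi> ((y(Suc n := z)) (Suc n)) \<partial>lborel) =
      (\<integral>\<^sup>+z. l (y 1) * (\<Prod>j=1..<n. K j (y j) (y (Suc j))) * (K n (y n) z * \<phi> z) \<partial>lborel)"
      unfolding prod using n by (simp add: mult_ac)
    then show "(\<integral>\<^sup>+z. l ((y(Suc n := z)) 1) * (\<Prod>j=1..<Suc n. K j ((y(Suc n := z)) j) ((y(Suc n := z)) (Suc j))) *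
        \<phi> ((y(Suc n := z)) (Suc n)) \<partial>lborel) =
      l (y 1) * (\<Prod>j=1..<n. K j (y j) (y (Suc j))) * (\<integral>\<^sup>+z. K n (y n) z * \<phi> z \<partial>lborel)"
      by (simp add: nn_integral_cmult)
  qed
  finally show ?thesis .
qed

lemma meander_weight_chain:
  fixes \<sigma> \<tau> :: "nat \<Rightarrow> real" and l :: "real \<Rightarrow> ennreal"
  assumes "m < d" and [measurable]: "l \<in> borel_measurable borel"
  defines "K \<equiv> \<lambda>j y z. ennreal (exp (- \<sigma> (d + 1 - j) * y)) * ennreal (killed_kernel (\<tau> (d - j)) y z)"
  shows "(\<integral>\<^sup>+y. l (y 1) * (\<Prod>j=1..<d. K j (y j) (y (Suc j))) * meander_weight \<sigma> \<tau> 0 (y d) \<partial>(\<Pi>\<^sub>M j\<in>{1..d}. lborel)) =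
    (\<integral>\<^sup>+y. l (y 1) * (\<Prod>j=1..<d-m. K j (y j) (y (Suc j))) * meander_weight \<sigma> \<tau> m (y (d - m)) \<partial>(\<Pi>\<^sub>M j\<in>{1..d-m}. lborel))"
  using assms(1)
proof (induction m)
  case (Suc m)
  define n where "n = d - Suc m"
  have n: "n \<ge> 1" "d - m = Suc n" "d = n + m + 1" using Suc.prems by (auto simp: n_def)
  have K_meas: "case_prod (K j) \<in> borel_measurable (borel \<Otimes>\<^sub>M borel)" for j
    unfolding K_def by measurable
  have "(\<integral>\<^sup>+z. K n y z * meander_weight \<sigma> \<tau> m z \<partial>lborel) = meander_weight \<sigma> \<tau> (Suc m) y" for y
    by (simp add: K_def n(3) mult.assoc nn_integral_cmult)
  then show ?case
    using Suc nn_integral_chain_peel[OF n(1) assms(2) meander_weight_measurable[of \<sigma> \<tau> m] K_meas]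
    by (simp add: n(2) n_def[symmetric] del: meander_weight.simps prod.op_ivl_Suc)
qed simp

lemma meander_weight_chain_total:
  fixes \<sigma> \<tau> :: "nat \<Rightarrow> real" and l :: "real \<Rightarrow> ennreal"
  assumes "d \<ge> 1" and [measurable]: "l \<in> borel_measurable borel"
  shows "(\<integral>\<^sup>+y. l (y 1) *
      (\<Prod>j=1..<d. ennreal (exp (- \<sigma> (d + 1 - j) * y j)) * ennreal (killed_kernel (\<tau> (d - j)) (y j) (y (Suc j)))) *
      meander_weight \<sigma> \<tau> 0 (y d) \<partial>(\<Pi>\<^sub>M j\<in>{1..d}. lborel)) =
    (\<integral>\<^sup>+y. l y * meander_weight \<sigma> \<tau> (d - 1) y \<partial>lborel)"
proof -
  interpret product_sigma_finite "\<lambda>_::nat. lborel :: real measure" ..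
  have "d - (d - 1) = 1" using assms(1) by simp
  then show ?thesis
    using meander_weight_chain[of "d - 1" d l \<sigma> \<tau>] assms(1)
      product_nn_integral_singleton[of "\<lambda>y. l y * meander_weight \<sigma> \<tau> (d - 1) y" 1]
    by simp
qed

context brownian_meander
begin

lemma B_measurable:
  assumes "0 \<le> u" "u \<le> 1"
  shows "B u \<in> borel_measurable M"
proof (cases "u = 0")
  case True
  then show ?thesis using random_variable_zero by simp
next
  case False
  have "(\<lambda>\<omega>. \<lambda>k\<in>{1..1::nat}. B u \<omega>) \<in> measurable M (\<Pi>\<^sub>M k\<in>{1..1}. lborel)"
    using joint_density[of 1 "\<lambda>_. u"] assms False by (intro distributed_measurable) auto
  from measurable_compose[OF this measurable_component_singleton[of 1]]
  show ?thesis by simp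
qed

lemma B_measurable_times:
  fixes t :: "nat \<Rightarrow> real" and d k :: nat
  assumes t: "t 0 = 0" "t 0 \<le> t 1" "\<And>k. k \<in> {1..<d} \<Longrightarrow> t k < t (k + 1)" "t d \<le> 1"
    and k: "k \<in> {1..d}"
  shows "B (1 - t k) \<in> borel_measurable M"
proof (rule B_measurable)
  have mono: "t i \<le> t j" if "i \<le> j" "1 \<le> i" "j \<le> d" for i j
    using that
  proof (induction j rule: dec_induct)
    case (step n)
    then show ?case using t(3)[of n] by simp
  qed simp
  show "0 \<le> 1 - t k" "1 - t k \<le> 1" using mono[of k d] mono[of 1 k] k t(1,2,4) by auto
qed

text \<open>
  The joint density is a chain of kernels that ends with the survival probability. The exponential
  weight splits over the coordinates: each but the last is attached to the kernel that starts there,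
  and the last one to the survival probability, which gives \<open>meander_weight \<sigma> \<tau> 0\<close>.
\<close>
lemma laplace_transform_weight:
  fixes \<sigma> \<tau> t :: "nat \<Rightarrow> real"
  assumes d: "d \<ge> 1"
    and t: "t 0 = 0" "t 0 \<le> t 1" "\<And>k. k \<in> {1..<d} \<Longrightarrow> t k < t (k + 1)" "t d < 1" "t (d + 1) = 1"
    and \<tau>_def: "\<And>k. \<tau> k = t (k + 1) - t k"
  shows "(\<integral>\<^sup>+\<omega>. ennreal (exp (- (\<Sum>k=1..d. \<sigma> k * B (1 - t k) \<omega>))) \<partial>M) =
    ennreal (sqrt (2 * pi)) * (\<integral>\<^sup>+y. ennreal (meander_entrance (\<tau> d) y) * meander_weight \<sigma> \<tau> (d - 1) y \<partial>lborel)"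
proof -
  \<comment> \<open>The joint density lists times in increasing order, which reverses the order of \<open>t\<close>.\<close>
  define r where "r = (\<lambda>j. 1 - t (d + 1 - j))"
  have t_step: "t (d - k) < t (Suc (d - k))" if "k \<in> {1..<d}" for k
    using t(3)[of "d - k"] that by auto
  have t1: "t 1 \<ge> 0" using t by simp
  have dist: "distributed M (\<Pi>\<^sub>M k\<in>{1..d}. lborel) (\<lambda>\<omega>. \<lambda>k\<in>{1..d}. B (r k) \<omega>) (\<lambda>y. ennreal (meander_density d r y))"
  proof (rule joint_density)
    show "r k < r (k + 1)" if "k \<in> {1..<d}" for k
      using t_step[OF that] that by (simp add: r_def Suc_diff_le)
  qed (use d t t1 in \<open>auto simp: r_def\<close>)
  let ?g = "\<lambda>y. ennreal (exp (- (\<Sum>j=1..d. \<sigma> (d + 1 - j) * y j)))"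
  have comp: "(\<lambda>y :: nat \<Rightarrow> real. y j) \<in> borel_measurable (\<Pi>\<^sub>M j\<in>{1..d}. lborel)" if "j \<in> {1..d}" for j
    using measurable_component_singleton[OF that, of "\<lambda>_. lborel :: real measure"] by simp
  have g_meas: "?g \<in> borel_measurable (\<Pi>\<^sub>M j\<in>{1..d}. lborel)"
    by (intro measurable_compose[OF _ measurable_ennreal] borel_measurable_exp[THEN measurable_compose[rotated]]
        borel_measurable_uminus borel_measurable_sum borel_measurable_times comp) auto
  have "(\<integral>\<^sup>+\<omega>. ennreal (exp (- (\<Sum>k=1..d. \<sigma> k * B (1 - t k) \<omega>))) \<partial>M) =
      (\<integral>\<^sup>+\<omega>. ?g (\<lambda>k\<in>{1..d}. B (r k) \<omega>) \<partial>M)"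
    by (intro nn_integral_cong)
       (subst sum.atLeastAtMost_rev, auto simp: r_def intro!: arg_cong[where f = ennreal] sum.cong)
  also have "\<dots> = (\<integral>\<^sup>+y. ennreal (meander_density d r y) * ?g y \<partial>(\<Pi>\<^sub>M k\<in>{1..d}. lborel))"
    by (rule distributed_nn_integral[OF dist g_meas, symmetric])
  also have "\<dots> = (\<integral>\<^sup>+y. ennreal (sqrt (2 * pi)) * ennreal (meander_entrance (\<tau> d) (y 1)) *
      (\<Prod>j=1..<d. ennreal (exp (- \<sigma> (d + 1 - j) * y j)) * ennreal (killed_kernel (\<tau> (d - j)) (y j) (y (Suc j)))) *
      meander_weight \<sigma> \<tau> 0 (y d) \<partial>(\<Pi>\<^sub>M k\<in>{1..d}. lborel))"
  proof (rule nn_integral_cong)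
    fix y :: "nat \<Rightarrow> real"
    have kernel: "(\<Prod>k=1..<d. killed_kernel (r (k + 1) - r k) (y k) (y (k + 1))) =
        (\<Prod>k=1..<d. killed_kernel (\<tau> (d - k)) (y k) (y (Suc k)))"
      by (rule prod.cong) (auto simp: r_def \<tau>_def Suc_diff_le)
    have "{1..d} = insert d {1..<d}" using d by auto
    then have "exp (- (\<Sum>j=1..d. \<sigma> (d + 1 - j) * y j)) =
        exp (- \<sigma> 1 * y d) * exp (\<Sum>j=1..<d. - \<sigma> (d + 1 - j) * y j)"
      by (simp add: exp_add[symmetric] sum_negf)
    also have "exp (\<Sum>j=1..<d. - \<sigma> (d + 1 - j) * y j) = (\<Prod>j=1..<d. exp (- \<sigma> (d + 1 - j) * y j))"
      by (rule exp_sum) simp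
    finally have weight: "exp (- (\<Sum>j=1..d. \<sigma> (d + 1 - j) * y j)) =
        exp (- \<sigma> 1 * y d) * (\<Prod>j=1..<d. exp (- \<sigma> (d + 1 - j) * y j))" .
    have \<tau>_nonneg: "\<tau> (d - j) \<ge> 0" if "j \<in> {1..<d}" for j
      using t_step[OF that] by (simp add: \<tau>_def)
    have h: "1 - r d = \<tau> 0" "r 1 = \<tau> d" "\<tau> 0 \<ge> 0" "\<tau> d \<ge> 0" using d t by (auto simp: r_def \<tau>_def)
    let ?k = "\<Prod>j=1..<d. killed_kernel (\<tau> (d - j)) (y j) (y (Suc j))"
    let ?e = "\<Prod>j=1..<d. exp (- \<sigma> (d + 1 - j) * y j)"
    have k: "?k \<ge> 0" by (intro prod_nonneg killed_kernel_nonneg ballI \<tau>_nonneg)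
    have e: "?e \<ge> 0" by (intro prod_nonneg) auto
    have prod: "(\<Prod>j=1..<d. ennreal (exp (- \<sigma> (d + 1 - j) * y j)) * ennreal (killed_kernel (\<tau> (d - j)) (y j) (y (Suc j)))) =
        ennreal ?e * ennreal ?k"
      unfolding prod.distrib
      by (subst (1 2) prod_ennreal) (auto simp: killed_kernel_nonneg \<tau>_nonneg)
    have mw: "meander_weight \<sigma> \<tau> 0 (y d) = ennreal (exp (- \<sigma> 1 * y d) * killed_survival (\<tau> 0) (y d))"
      using killed_survival_support[of "y d" "\<tau> 0"] by (cases "y d > 0") auto
    show "ennreal (meander_density d r y) * ?g y = ennreal (sqrt (2 * pi)) * ennreal (meander_entrance (\<tau> d) (y 1)) *
      (\<Prod>j=1..<d. ennreal (exp (- \<sigma> (d + 1 - j) * y j)) * ennreal (killed_kernel (\<tau> (d - j)) (y j) (y (Suc j)))) *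
      meander_weight \<sigma> \<tau> 0 (y d)"
      unfolding meander_density_def kernel weight prod mw h(1,2)
      using k e h(3,4) killed_survival_nonneg[OF h(3), of "y d"] meander_entrance_nonneg[OF h(4), of "y 1"]
      by (simp add: ennreal_mult[symmetric] mult_ac del: ennreal_mult'')
  qed
  also have "\<dots> = (\<integral>\<^sup>+y. ennreal (sqrt (2 * pi)) * ennreal (meander_entrance (\<tau> d) y) * meander_weight \<sigma> \<tau> (d - 1) y \<partial>lborel)"
    by (rule meander_weight_chain_total[OF d, where l = "\<lambda>y. ennreal (sqrt (2 * pi)) * ennreal (meander_entrance (\<tau> d) y)"]) measurable
  finally show ?thesis by (simp add: mult.assoc nn_integral_cmult)
qed

end

section \<open>The Laplace identity\<close>

text \<open>
  Both sides are multiples of the integral of \<open>u\<close> against the damped sine transform, with the factor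
  \<open>sqrt (2 \<pi>) / \<pi>\<close> from the entrance law on the left and \<open>2 / sqrt (2 \<pi>)\<close> from the Jacobian \<open>2 u\<close>
  on the right.
\<close>
lemma laplace_duality:
  assumes d: "d \<ge> 1" and s: "\<And>j. 1 \<le> j \<Longrightarrow> j \<le> d \<Longrightarrow> \<sigma> j > 0"
    and tau0: "\<tau> 0 \<ge> 0" and tau: "\<And>j. 1 \<le> j \<Longrightarrow> j \<le> d \<Longrightarrow> \<tau> j > 0"
  shows "ennreal (sqrt (2 * pi)) * (\<integral>\<^sup>+y. ennreal (meander_entrance (\<tau> d) y) * meander_weight \<sigma> \<tau> (d - 1) y \<partial>lborel) =
    ennreal (1 / sqrt (2 * pi)) * (\<integral>\<^sup>+y. process_weight \<sigma> \<tau> d y \<partial>lborel)"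
proof -
  have d1: "d - 1 + 1 = d" "Suc (d - 1) = d" using d by auto
  obtain F where F: "integrable lborel F" "\<And>y. F y \<ge> 0" "\<And>y. y \<le> 0 \<Longrightarrow> F y = 0"
    and mF: "\<And>y. meander_weight \<sigma> \<tau> (d - 1) y = ennreal (F y)"
    and A_nonneg: "\<And>v. v > 0 \<Longrightarrow> damped_sine_transform (\<tau> d) F v \<ge> 0"
    and A: "\<And>v. v > 0 \<Longrightarrow> process_weight \<sigma> \<tau> d (v\<^sup>2) = ennreal (damped_sine_transform (\<tau> d) F v)"
    using sine_duality[of "d - 1" \<sigma> \<tau>] s tau0 tau unfolding d1 by blast
  have t: "\<tau> d > 0" using tau d by simp
  let ?A = "damped_sine_transform (\<tau> d) F"
  note ent = meander_entrance_damped_sine[OF t F(1,3)]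
  have uA: "u * ?A u \<ge> 0" for u
    using A_nonneg[of u] by (cases "u > 0") (auto simp: damped_sine_transform_def)
  have I: "(\<integral>u. u * ?A u \<partial>lborel) \<ge> 0" by (intro Bochner_Integration.integral_nonneg uA)
  have "(\<integral>\<^sup>+y. ennreal (meander_entrance (\<tau> d) y) * meander_weight \<sigma> \<tau> (d - 1) y \<partial>lborel) =
      (\<integral>\<^sup>+y. ennreal (meander_entrance (\<tau> d) y * F y) \<partial>lborel)"
    unfolding mF using t F(2) by (simp add: ennreal_mult meander_entrance_nonneg)
  also have "\<dots> = ennreal (\<integral>y. meander_entrance (\<tau> d) y * F y \<partial>lborel)"
    using ent(1) t F(2) by (intro nn_integral_eq_integral) (auto simp: meander_entrance_nonneg)
  finally have left: "(\<integral>\<^sup>+y. ennreal (meander_entrance (\<tau> d) y) * meander_weight \<sigma> \<tau> (d - 1) y \<partial>lborel) =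
      ennreal (1 / pi * (\<integral>u. u * ?A u \<partial>lborel))"
    by (simp only: ent(3))
  have "(\<integral>\<^sup>+y. process_weight \<sigma> \<tau> d y \<partial>lborel) = (\<integral>\<^sup>+y. process_weight \<sigma> \<tau> d y * indicator {0<..} y \<partial>lborel)"
    by (rule nn_integral_cong) (auto simp: process_weight_support split: split_indicator)
  also have "\<dots> = (\<integral>\<^sup>+u. process_weight \<sigma> \<tau> d (u\<^sup>2) * ennreal (2 * u) * indicator {0<..} u \<partial>lborel)"
    by (rule nn_integral_square_substitution) measurable
  also have "\<dots> = (\<integral>\<^sup>+u. ennreal (2 * (u * ?A u)) \<partial>lborel)"
  proof (rule nn_integral_cong)
    fix u :: real
    show "process_weight \<sigma> \<tau> d (u\<^sup>2) * ennreal (2 * u) * indicator {0<..} u = ennreal (2 * (u * ?A u))"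
      using A_nonneg[of u] by (cases "u > 0") (auto simp: A ennreal_mult[symmetric] damped_sine_transform_def mult_ac)
  qed
  also have "\<dots> = ennreal (\<integral>u. 2 * (u * ?A u) \<partial>lborel)"
    using ent(2) uA by (intro nn_integral_eq_integral) auto
  finally have right: "(\<integral>\<^sup>+y. process_weight \<sigma> \<tau> d y \<partial>lborel) = ennreal (2 * (\<integral>u. u * ?A u \<partial>lborel))"
    by simp
  have "sqrt (2 * pi) * (1 / pi) = 1 / sqrt (2 * pi) * 2"
    by (simp add: field_simps)
  then have "sqrt (2 * pi) * (1 / pi * c) = 1 / sqrt (2 * pi) * (2 * c)" for c
    by (simp only: mult.assoc[symmetric])
  then show ?thesis
    unfolding left right using I by (subst (1 2) ennreal_mult[symmetric]) simp_all
qed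

lemma laplace_identity_interior:
  fixes d :: nat and s t :: "nat \<Rightarrow> real"
    and M :: "'a measure" and B :: "real \<Rightarrow> 'a \<Rightarrow> real"
    and P :: "real \<Rightarrow> 'b measure" and X :: "real \<Rightarrow> 'b \<Rightarrow> real"
  assumes d: "d \<ge> 1"
    and s: "s 0 = 0" "\<And>k. k < d \<Longrightarrow> s k < s (k + 1)"
    and t: "t 0 = 0" "t 0 \<le> t 1" "\<And>k. k \<in> {1..<d} \<Longrightarrow> t k < t (k + 1)" "t d < 1" "t (d + 1) = 1"
    and meander: "brownian_meander M B"
    and process: "\<And>x. x > 0 \<Longrightarrow> markov_process_from (P x) X x"
  shows "(\<integral>\<omega>. exp (- (\<Sum>k=1..d. (s k - s (k - 1)) * B (1 - t k) \<omega>)) \<partial>M) =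
    1 / sqrt (2 * pi) *
      (LINT x:{0<..}|lborel.
         (\<integral>\<omega>. exp (- (1 / 2) * (\<Sum>k=0..d. (t (k + 1) - t k) * X (s k) \<omega>)) \<partial>P x) * (1 / sqrt x))"
proof -
  interpret brownian_meander M B by (rule meander)
  define \<sigma> where "\<sigma> = (\<lambda>k. s k - s (k - 1))"
  define \<tau> where "\<tau> = (\<lambda>k. t (k + 1) - t k)"
  have \<sigma>: "\<sigma> j > 0" if "1 \<le> j" "j \<le> d" for j
    using s(2)[of "j - 1"] that by (simp add: \<sigma>_def)
  have \<tau>0: "\<tau> 0 \<ge> 0" using t by (simp add: \<tau>_def)
  have \<tau>: "\<tau> j > 0" if "1 \<le> j" "j \<le> d" for j
    using t(3)[of j] t(4,5) that by (cases "j = d") (auto simp: \<tau>_def)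
  have [measurable]: "B (1 - t k) \<in> borel_measurable M" if "k \<in> {1..d}" for k
    using B_measurable_times[OF t(1-3) less_imp_le[OF t(4)] that] .
  have "(\<integral>\<omega>. exp (- (\<Sum>k=1..d. \<sigma> k * B (1 - t k) \<omega>)) \<partial>M) =
      enn2real (\<integral>\<^sup>+\<omega>. ennreal (exp (- (\<Sum>k=1..d. \<sigma> k * B (1 - t k) \<omega>))) \<partial>M)"
    by (rule integral_eq_nn_integral) auto
  also have "(\<integral>\<^sup>+\<omega>. ennreal (exp (- (\<Sum>k=1..d. \<sigma> k * B (1 - t k) \<omega>))) \<partial>M) =
      ennreal (1 / sqrt (2 * pi)) * (\<integral>\<^sup>+y. process_weight \<sigma> \<tau> d y \<partial>lborel)"
    using laplace_transform_weight[OF d t, of \<tau> \<sigma>] laplace_duality[of d \<sigma> \<tau>, OF d \<sigma> \<tau>0 \<tau>]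
    by (simp add: \<tau>_def)
  also have "enn2real \<dots> = 1 / sqrt (2 * pi) * enn2real (\<integral>\<^sup>+y. process_weight \<sigma> \<tau> d y \<partial>lborel)"
    by (simp add: enn2real_mult)
  also have "enn2real (\<integral>\<^sup>+y. process_weight \<sigma> \<tau> d y \<partial>lborel) =
      (LINT x:{0<..}|lborel. (\<integral>\<omega>. exp (- (1 / 2) * (\<Sum>k=0..d. \<tau> k * X (s k) \<omega>)) \<partial>P x) * (1 / sqrt x))"
    unfolding \<sigma>_def
  proof (rule process_weight_laplace[of P X s d \<tau>, OF process s(1), symmetric])
    show "\<tau> j \<ge> 0" if "j \<le> d" for j
      using \<tau>0 \<tau>[of j] that by (cases "j = 0") (auto intro: less_imp_le)
  qed (use s in auto)
  finally show ?thesis unfolding \<sigma>_def \<tau>_def .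
qed

text \<open>
  The integral on the right-hand side for \<open>d = 1\<close> and \<open>t 1 = 1\<close>, where no transition of the process
  is left: the substitution \<open>x = u\<^sup>2\<close> gives a Gaussian integral.
\<close>
lemma process_weight_0_total: "(\<integral>\<^sup>+x. process_weight \<sigma> (\<lambda>_. 1) 0 x \<partial>lborel) = ennreal (sqrt (2 * pi))"
proof -
  let ?G = "\<lambda>u::real. exp (- 1 * u\<^sup>2 / 2) * indicator {0<..} u"
  have "(\<integral>\<^sup>+x. process_weight \<sigma> (\<lambda>_. 1) 0 x \<partial>lborel) =
      (\<integral>\<^sup>+x. ennreal (exp (- x / 2) / sqrt x) * indicator {0<..} x \<partial>lborel)"
    by (intro nn_integral_cong) (auto split: split_indicator)
  also have "\<dots> = (\<integral>\<^sup>+u. ennreal (exp (- u\<^sup>2 / 2) / sqrt (u\<^sup>2)) * ennreal (2 * u) * indicator {0<..} u \<partial>lborel)"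
    by (rule nn_integral_square_substitution) measurable
  also have "\<dots> = (\<integral>\<^sup>+u. ennreal (2 * ?G u) \<partial>lborel)"
    by (intro nn_integral_cong) (auto simp: ennreal_mult[symmetric] split: split_indicator)
  also have "\<dots> = ennreal (\<integral>u. 2 * ?G u \<partial>lborel)"
    using gaussian_half_line_integrable[of 1] by (intro nn_integral_eq_integral integrable_mult_right) auto
  also have "(\<integral>u. 2 * ?G u \<partial>lborel) = 2 * sqrt (pi / 2)"
    using gaussian_cosine[of 1 0] by simp
  also have "\<dots> = sqrt (2 * pi)"
    by (simp add: real_sqrt_mult real_sqrt_divide field_simps)
  finally show ?thesis .
qed

theorem theorem1p2:
  fixes d :: nat and s t :: "nat \<Rightarrow> real"
    and M :: "'a measure" and B :: "real \<Rightarrow> 'a \<Rightarrow> real"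
    and P :: "real \<Rightarrow> 'b measure" and X :: "real \<Rightarrow> 'b \<Rightarrow> real"
  assumes "d \<ge> 1"
    and "s 0 = 0" and "\<And>k. k < d \<Longrightarrow> s k < s (k + 1)"
    and "t 0 = 0" and "t 0 \<le> t 1" and "\<And>k. k \<in> {1..<d} \<Longrightarrow> t k < t (k + 1)"
    and "t d \<le> 1" and "t (d + 1) = 1"
    and "brownian_meander M B"
    and "\<And>x. x > 0 \<Longrightarrow> markov_process_from (P x) X x"
  shows "(\<integral>\<omega>. exp (- (\<Sum>k=1..d. (s k - s (k - 1)) * B (1 - t k) \<omega>)) \<partial>M) =
    1 / sqrt (2 * pi) *
      (LINT x:{0<..}|lborel.
         (\<integral>\<omega>. exp (- (1 / 2) * (\<Sum>k=0..d. (t (k + 1) - t k) * X (s k) \<omega>)) \<partial>P x) * (1 / sqrt x))"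
proof (cases "t d < 1")
  case True
  then show ?thesis
    using assms by (intro laplace_identity_interior) auto
next
  case False
  interpret brownian_meander M B by (rule assms(9))
  have td: "t d = 1" using False assms(7) by simp
  obtain e where e: "d = Suc e" using assms(1) by (cases d) auto
  \<comment> \<open>The meander vanishes at time \<open>1 - t d = 0\<close> and the state of the process at the last time has weight \<open>0\<close>; what remains is the claim for \<open>e\<close> times.\<close>
  have sum_X: "(\<Sum>k=0..d. (t (k + 1) - t k) * X (s k) \<omega>) = (\<Sum>k=0..e. (t (k + 1) - t k) * X (s k) \<omega>)" for \<omega>
    using td assms(8) by (simp add: e)
  show ?thesis
  proof (cases "e = 0")
    case True
    have "(\<integral>\<omega>. exp (- (\<Sum>k=1..d. (s k - s (k - 1)) * B (1 - t k) \<omega>)) \<partial>M) = (\<integral>\<omega>. 1 \<partial>M)"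
      by (rule integral_cong_AE) (use start_zero random_variable_zero td True e in auto)
    moreover have "(LINT x:{0<..}|lborel. (\<integral>\<omega>. exp (- (1 / 2) * (\<Sum>k=0..e. (t (k + 1) - t k) * X (s k) \<omega>)) \<partial>P x) * (1 / sqrt x)) = sqrt (2 * pi)"
      using process_weight_laplace[of P X s 0 "\<lambda>_. 1", OF assms(10,2)] process_weight_0_total td assms(4) True e by simp
    ultimately show ?thesis
      unfolding sum_X by (simp add: prob_space)
  next
    case False
    have "(\<integral>\<omega>. exp (- (\<Sum>k=1..d. (s k - s (k - 1)) * B (1 - t k) \<omega>)) \<partial>M) =
        (\<integral>\<omega>. exp (- (\<Sum>k=1..e. (s k - s (k - 1)) * B (1 - t k) \<omega>)) \<partial>M)"
    proof (rule integral_cong_AE)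
      have meas [measurable]: "B (1 - t k) \<in> borel_measurable M" if "k \<in> {1..d}" for k
        using B_measurable_times[OF assms(4-7) that] .
      show "(\<lambda>\<omega>. exp (- (\<Sum>k=1..d. (s k - s (k - 1)) * B (1 - t k) \<omega>))) \<in> borel_measurable M"
        by measurable
      have [measurable]: "B (1 - t k) \<in> borel_measurable M" if "k \<in> {1..e}" for k
        using that e by (intro meas) auto
      show "(\<lambda>\<omega>. exp (- (\<Sum>k=1..e. (s k - s (k - 1)) * B (1 - t k) \<omega>))) \<in> borel_measurable M"
        by measurable
      show "AE \<omega> in M. exp (- (\<Sum>k=1..d. (s k - s (k - 1)) * B (1 - t k) \<omega>)) =
          exp (- (\<Sum>k=1..e. (s k - s (k - 1)) * B (1 - t k) \<omega>))"
        using start_zero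
      proof eventually_elim
        case (elim \<omega>)
        have "B (1 - t d) \<omega> = 0" using elim td by simp
        then show ?case unfolding e by simp
      qed
    qed
    also have "\<dots> = 1 / sqrt (2 * pi) *
      (LINT x:{0<..}|lborel.
         (\<integral>\<omega>. exp (- (1 / 2) * (\<Sum>k=0..e. (t (k + 1) - t k) * X (s k) \<omega>)) \<partial>P x) * (1 / sqrt x))"
      using assms False td e assms(6)[of e] by (intro laplace_identity_interior) auto
    finally show ?thesis unfolding sum_X .
  qed
qed

end
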